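(* Let $F$ be a field of characteristic zero and let $\mathcal{U}=UT_3(F)$ with the elementary $\mathbb{Z}_2$-grading induced by $(0,1,0)$ and the reflection involution $\ast$. Then $$c_n^{\mathbb{Z}_2,\ast}(\mathcal{U})=2n(n+5)3^{n-2}-(n-2)2^{n-1}-n$$ for all $n\ge 0$.
   Context: $UT_3(F)$ is the algebra of $3\times3$ upper triangular matrices with elementary matrices $E_{i,j}$. The elementary $\mathbb{Z}_2$-grading induced by $(0,1,0)$ has $\deg E_{i,j}=g_i-g_j$ with $(g_1,g_2,g_3)=(0,1,0)$. The reflection involution is the linear map with $E_{i,j}^\ast=E_{4-j,4-i}$; it preserves the homogeneous components. Let $Y^{+},Y^{-},Z^{+},Z^{-}$ be pairwise disjoint sets of indeterminates $y_i^{+},y_i^{-},z_i^{+},z_i^{-}$ ($i\ge1$). In the free associative algebra on these indeterminates, elements of $Y^\pm$ have degree $0$, elements of $Z^\pm$ have degree $1$, and those with sign $+$ are symmetric and those with sign $-$ skew-symmetric with respect to the involution. A polynomial is a $(\mathbb{Z}_2,\ast)$-identity for $\mathcal{U}$ if it vanishes under all substitutions of the indeterminates by elements of $\mathcal{U}$ that are homogeneous of the corresponding degree and symmetric or skew-symmetric accordingly; $T_{\mathbb{Z}_2,\ast}(\mathcal{U})$ is the set of these. $P_n^{\mathbb{Z}_2,\ast}$ is the span of the multilinear monomials of degree $n$ in which each index $i=1,\dots,n$ appears exactly once (the indeterminate with index $i$ being one of $y_i^+,y_i^-,z_i^+,z_i^-$), with $P_0^{\mathbb{Z}_2,\ast}=F$,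 and $c_n^{\mathbb{Z}_2,\ast}(\mathcal{U})=\dim P_n^{\mathbb{Z}_2,\ast}/(P_n^{\mathbb{Z}_2,\ast}\cap T_{\mathbb{Z}_2,\ast}(\mathcal{U}))$. *)

theory Defs
  imports
    "HOL-Library.Poly_Mapping"
    "HOL-Library.Z2"
    "HOL-Algebra.AbelCoset"
    "Jordan_Normal_Form.VS_Connect"
begin

text \<open>All indices start at 0. The constructors stand for the indeterminates
  \<open>y\<^sub>i\<^sup>+\<close>, \<open>y\<^sub>i\<^sup>-\<close>, \<open>z\<^sub>i\<^sup>+\<close>, \<open>z\<^sub>i\<^sup>-\<close>.\<close>

datatype indet = Yp (idx: nat) | Ym (idx: nat) | Zp (idx: nat) | Zm (idx: nat)

text \<open>Words form the free monoid under concatenation. With this instance, multiplication on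
  \<open>indet list \<Rightarrow>\<^sub>0 'f\<close> is the convolution product, which makes the type the
  free associative unital algebra on \<open>indet\<close>.\<close>

instantiation list :: (type) monoid_add
begin
definition zero_list :: "'a list" where "zero_list = []"
definition plus_list :: "'a list \<Rightarrow> 'a list \<Rightarrow> 'a list" where "plus_list = (@)"
instance by standard (simp_all add: zero_list_def plus_list_def)
end

type_synonym 'f free_alg = "indet list \<Rightarrow>\<^sub>0 'f"

definition free_alg :: "('f::field, 'f free_alg) module" where
  "free_alg = \<lparr>carrier = UNIV, mult = (*), one = 1, zero = 0, add = (+),
     smult = (\<lambda>c. Poly_Mapping.map ((*) c))\<rparr>"

definition quotient_module :: "('f, 'v, 'm) module_scheme \<Rightarrow> 'v set \<Rightarrow> ('f, 'v set) module" where
  "quotient_module M W = \<lparr>carrier = a_rcosets\<^bsub>M\<^esub> W, mult = undefined, one = undefined,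
     zero = W, add = set_add M,
     smult = (\<lambda>c C. \<Union>x\<in>C. W +>\<^bsub>M\<^esub> (c \<odot>\<^bsub>M\<^esub> x))\<rparr>"

definition UT3 :: "'f::field mat set" where
  "UT3 = {A \<in> carrier_mat 3 3. upper_triangular A}"

definition grading_tuple :: "bit list" where
  "grading_tuple = [0, 1, 0]"

text \<open>The span of the matrix units in \<open>UT3\<close> at the positions \<open>(i, j)\<close> of degree \<open>k\<close>.\<close>

definition component :: "bit \<Rightarrow> 'f::field mat set" where
  "component k = {A \<in> UT3. \<forall>i<3. \<forall>j<3. A $$ (i, j) \<noteq> 0 \<longrightarrow> grading_tuple ! i - grading_tuple ! j = k}"

definition reflection :: "'f::field mat \<Rightarrow> 'f mat" where
  "reflection A = mat 3 3 (\<lambda>(i, j). A $$ (2 - j, 2 - i))"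

fun admissible :: "indet \<Rightarrow> 'f::field mat set" where
  "admissible (Yp i) = {A \<in> component 0. reflection A = A}"
| "admissible (Ym i) = {A \<in> component 0. reflection A = - A}"
| "admissible (Zp i) = {A \<in> component 1. reflection A = A}"
| "admissible (Zm i) = {A \<in> component 1. reflection A = - A}"

definition eval_word :: "(indet \<Rightarrow> 'f::field mat) \<Rightarrow> indet list \<Rightarrow> 'f mat" where
  "eval_word \<phi> w = foldr (\<lambda>x B. \<phi> x * B) w (1\<^sub>m 3)"

definition eval_poly :: "(indet \<Rightarrow> 'f::field mat) \<Rightarrow> 'f free_alg \<Rightarrow> 'f mat" where
  "eval_poly \<phi> p = (\<Oplus>\<^bsub>module_mat TYPE('f) 3 3\<^esub> w \<in> Poly_Mapping.keys p.
     Poly_Mapping.lookup p w \<cdot>\<^sub>m eval_word \<phi> w)"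

definition identities :: "'f::field free_alg set" where
  "identities = {p. \<forall>\<phi>. (\<forall>x. \<phi> x \<in> admissible x) \<longrightarrow> eval_poly \<phi> p = 0\<^sub>m 3 3}"

definition multilinear_words :: "nat \<Rightarrow> indet list set" where
  "multilinear_words n = {w. distinct (map idx w) \<and> set (map idx w) = {..<n}}"

definition multilinear_polys :: "nat \<Rightarrow> 'f::field free_alg set" where
  "multilinear_polys n = LinearCombinations.module.span class_ring free_alg
     ((\<lambda>w. Poly_Mapping.single w 1) ` multilinear_words n)"

definition codimension :: "'f::field itself \<Rightarrow> nat \<Rightarrow> nat" where
  "codimension (_ :: 'f itself) n = vectorspace.dim (class_ring :: 'f ring)
     (quotient_module (free_alg\<lparr>carrier := multilinear_polys n\<rparr>)
       (multilinear_polys n \<inter> identities :: 'f free_alg set))"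

end

theory Submission
  imports Defs
begin

text \<open>
  An admissible value of an even indeterminate is determined by its entries at \<open>(0, 0)\<close>, \<open>(1, 1)\<close> and
  \<open>(0, 2)\<close>, of which the last two vanish for a skew one; an admissible value of an odd indeterminate is
  determined by its entry at \<open>(0, 1)\<close>. Hence a word with three odd letters is an identity, and the value
  of any other word is given by products of these entries.

  With one odd letter, the value depends only on which letters stand on either side of it, and it
  vanishes when skew even letters stand on both sides. With two odd letters, it depends up to sign only
  on the letters between them, and vanishes when one of those is skew. Without odd letters, the corner
  entry records for each symmetric letter the parity of the number of skew letters behind it; the word
  with all skew letters in front, together with the words in which a single parity is changed,
  represents everything. Evaluations at matrices with entries 0 and 1 separate the
  representatives, so counting them gives the codimension.
\<close>

section \<open>Dimension of a quotient space\<close>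

text \<open>Each entry of an evaluated word is a sum over paths in {0, 1, 2}: an even letter stays
  at its place or jumps from 0 to 2, an odd letter moves one place up. Hence the number of odd
  letters decides which entries survive. The involution identifies the entries at (2,2) and (1,2)
  with those at (0,0) and (0,1) up to sign, and these signs make the case without odd letters the
  delicate one: words with the same letters agree off the corner and differ there by a vector of
  signs, one for each of the s symmetric letters. The vectors (1, e) with e in {1, -1}^s span
  dimension s + 1, but without skew letters only e = (1, ..., 1) occurs. So a word is in general a
  combination of representatives and not a multiple of one, and a set M of skew indices contributes
  1 + (n - |M|), or just 1 if M is empty. Summing over M gives 2^n + n(2^(n-1) - 1). One and two odd
  letters add 2n(2 * 3^(n-1) - 2^(n-1)) and 2n(n-1) 3^(n-2), and the powers of 3 combine to 2n(n+5)
  3^(n-2).\<close>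

context vectorspace
begin

context
  fixes W
  assumes W: "submodule K W V"
begin

lemma submodule_abelian_subgroup: "abelian_subgroup W V"
proof -
  interpret W: submodule K W V by (fact W)
  have "subgroup W (add_monoid V)"
  proof
    show "W \<subseteq> carrier (add_monoid V)" using W.subset by simp
    fix x assume x: "x \<in> W"
    have "(\<ominus>\<^bsub>K\<^esub> \<one>\<^bsub>K\<^esub>) \<odot>\<^bsub>V\<^esub> x = \<ominus>\<^bsub>V\<^esub> x"
      using x W.subset by (metis smult_minus_1 subsetD)
    then have "\<ominus>\<^bsub>V\<^esub> x \<in> W"
      using x W.smult_closed[of "\<ominus>\<^bsub>K\<^esub> \<one>\<^bsub>K\<^esub>" x] by simp
    then show "inv\<^bsub>add_monoid V\<^esub> x \<in> W" by (simp add: a_inv_def)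
  qed auto
  then show ?thesis
    by (intro abelian_subgroupI3 additive_subgroupI) (simp_all add: M.abelian_group_axioms)
qed

interpretation abelian_subgroup W V by (rule submodule_abelian_subgroup)

lemma carrier_quotient: "carrier (quotient_module V W) = (\<lambda>x. W +>\<^bsub>V\<^esub> x) ` carrier V"
  by (auto simp: quotient_module_def A_RCOSETS_def')

lemma add_quotient:
  assumes "x \<in> carrier V" "y \<in> carrier V"
  shows "(W +>\<^bsub>V\<^esub> x) \<oplus>\<^bsub>quotient_module V W\<^esub> (W +>\<^bsub>V\<^esub> y) = W +>\<^bsub>V\<^esub> (x \<oplus>\<^bsub>V\<^esub> y)"
  using a_rcos_sum[OF assms] by (simp add: quotient_module_def)

lemma zero_quotient: "\<zero>\<^bsub>quotient_module V W\<^esub> = W +>\<^bsub>V\<^esub> \<zero>\<^bsub>V\<^esub>"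
  by (simp add: quotient_module_def a_coset_add_zero a_subset)

lemma coset_eq_iff:
  assumes "x \<in> carrier V" "y \<in> carrier V"
  shows "W +>\<^bsub>V\<^esub> x = W +>\<^bsub>V\<^esub> y \<longleftrightarrow> x \<ominus>\<^bsub>V\<^esub> y \<in> W"
proof -
  have "W +>\<^bsub>V\<^esub> x = W +>\<^bsub>V\<^esub> y \<longleftrightarrow> x \<in> W +>\<^bsub>V\<^esub> y"
    using assms a_repr_independence'[of x y] a_rcos_self[of x] by metis
  also have "\<dots> \<longleftrightarrow> x \<ominus>\<^bsub>V\<^esub> y \<in> W"
    using assms a_rcos_module[of y x] by (simp add: M.minus_eq)
  finally show ?thesis .
qed

text \<open>Scaling maps \<open>W\<close> into itself, so the cosets united in the scalar action of
  \<open>quotient_module\<close> all coincide and the union is a single coset.\<close>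

lemma smult_quotient:
  assumes c: "c \<in> carrier K" and x: "x \<in> carrier V"
  shows "c \<odot>\<^bsub>quotient_module V W\<^esub> (W +>\<^bsub>V\<^esub> x) = W +>\<^bsub>V\<^esub> (c \<odot>\<^bsub>V\<^esub> x)"
proof -
  have eq: "W +>\<^bsub>V\<^esub> (c \<odot>\<^bsub>V\<^esub> y) = W +>\<^bsub>V\<^esub> (c \<odot>\<^bsub>V\<^esub> x)" if y: "y \<in> W +>\<^bsub>V\<^esub> x" for y
  proof -
    have yV: "y \<in> carrier V" using y x a_elemrcos_carrier by blast
    have "W +>\<^bsub>V\<^esub> y = W +>\<^bsub>V\<^esub> x" using y x by (metis a_repr_independence')
    then have "y \<ominus>\<^bsub>V\<^esub> x \<in> W" using coset_eq_iff[OF yV x] by simp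
    then have "c \<odot>\<^bsub>V\<^esub> (y \<ominus>\<^bsub>V\<^esub> x) \<in> W" using W c by (simp add: submodule_def)
    also have "c \<odot>\<^bsub>V\<^esub> (y \<ominus>\<^bsub>V\<^esub> x) = c \<odot>\<^bsub>V\<^esub> y \<ominus>\<^bsub>V\<^esub> c \<odot>\<^bsub>V\<^esub> x"
      using x yV c by (simp add: M.minus_eq smult_r_distr smult_r_minus)
    finally show ?thesis using coset_eq_iff c x yV by simp
  qed
  have "x \<in> W +>\<^bsub>V\<^esub> x" using x by (rule a_rcos_self)
  then have "(\<Union>y\<in>W +>\<^bsub>V\<^esub> x. W +>\<^bsub>V\<^esub> (c \<odot>\<^bsub>V\<^esub> x)) = W +>\<^bsub>V\<^esub> (c \<odot>\<^bsub>V\<^esub> x)" by blast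
  moreover have "(\<Union>y\<in>W +>\<^bsub>V\<^esub> x. W +>\<^bsub>V\<^esub> (c \<odot>\<^bsub>V\<^esub> y)) = (\<Union>y\<in>W +>\<^bsub>V\<^esub> x. W +>\<^bsub>V\<^esub> (c \<odot>\<^bsub>V\<^esub> x))"
    by (intro SUP_cong refl eq)
  ultimately show ?thesis by (simp add: quotient_module_def)
qed

lemma vectorspace_quotient: "vectorspace K (quotient_module V W)" (is "vectorspace K ?Q")
proof -
  \<comment> \<open>The axioms quantify over cosets; passing to representatives reduces each to the
    same axiom of \<open>V\<close>.\<close>
  have all: "(\<forall>v. v \<in> carrier ?Q \<longrightarrow> P v) \<longleftrightarrow> (\<forall>x\<in>carrier V. P (W +>\<^bsub>V\<^esub> x))" for P
    unfolding carrier_quotient by blast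
  have im: "W +>\<^bsub>V\<^esub> x \<in> carrier ?Q" if "x \<in> carrier V" for x
    unfolding carrier_quotient using that by (rule imageI)
  note ops = zero_quotient add_quotient smult_quotient im
  show ?thesis
  proof (rule vs_criteria)
    show "field K" by unfold_locales
    show "\<forall>v\<in>carrier ?Q. \<exists>nv\<in>carrier ?Q. v \<oplus>\<^bsub>?Q\<^esub> nv = \<zero>\<^bsub>?Q\<^esub>"
    proof
      fix v assume "v \<in> carrier ?Q"
      then obtain x where x: "x \<in> carrier V" "v = W +>\<^bsub>V\<^esub> x" unfolding carrier_quotient by blast
      show "\<exists>nv\<in>carrier ?Q. v \<oplus>\<^bsub>?Q\<^esub> nv = \<zero>\<^bsub>?Q\<^esub>"
        by (rule bexI[of _ "W +>\<^bsub>V\<^esub> (\<ominus>\<^bsub>V\<^esub> x)"])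
          (simp_all only: ops x M.a_inv_closed M.r_neg)
    qed
    show "\<forall>v w. v \<in> carrier ?Q \<and> w \<in> carrier ?Q \<longrightarrow> v \<oplus>\<^bsub>?Q\<^esub> w = w \<oplus>\<^bsub>?Q\<^esub> v"
      by (simp only: imp_conjL all_simps all Ball_def ops) (metis add_quotient M.a_comm)
  qed (simp_all only: imp_conjL all_simps all Ball_def ops M.add.m_closed M.zero_closed smult_closed M.a_assoc
      smult_l_distr smult_r_distr smult_assoc1 smult_one M.r_zero imp_refl simp_thms m_closed a_closed one_closed R.a_closed R.m_closed cong: imp_cong)
qed

lemma mod_hom_quotient: "mod_hom K V (quotient_module V W) (\<lambda>x. W +>\<^bsub>V\<^esub> x)"
proof -
  have im: "W +>\<^bsub>V\<^esub> x \<in> carrier (quotient_module V W)" if "x \<in> carrier V" for x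
    unfolding carrier_quotient using that by (rule imageI)
  have "(\<lambda>x. W +>\<^bsub>V\<^esub> x) \<in> LinearCombinations.module_hom K V (quotient_module V W)"
    unfolding LinearCombinations.module_hom_def by (clarsimp simp: add_quotient smult_quotient im)
  then show ?thesis
    using vectorspace_quotient module_axioms
    by (simp only: mod_hom_def mod_hom_axioms_def vectorspace_def simp_thms)
qed

text \<open>Both conditions are phrased with elements of \<open>V\<close> modulo \<open>W\<close>,
  so that later no coset has to be handled. Together they make the projection injective on
  \<open>R\<close> with a basis as image.\<close>

lemma dim_quotient:
  assumes R: "finite R" "R \<subseteq> carrier V"
    and spanning: "\<And>v. v \<in> carrier V \<Longrightarrow> \<exists>c\<in>R \<rightarrow> carrier K. v \<ominus>\<^bsub>V\<^esub> lincomb c R \<in> W"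
    and indep: "\<And>c r. c \<in> R \<rightarrow> carrier K \<Longrightarrow> lincomb c R \<in> W \<Longrightarrow> r \<in> R \<Longrightarrow> c r = \<zero>\<^bsub>K\<^esub>"
  shows "vectorspace.dim K (quotient_module V W) = card R"
proof -
  let ?Q = "quotient_module V W" and ?p = "\<lambda>x. W +>\<^bsub>V\<^esub> x"
  interpret Q: vectorspace K ?Q by (rule vectorspace_quotient)
  interpret p: mod_hom K V ?Q ?p by (rule mod_hom_quotient)
  have zero_iff: "?p x = \<zero>\<^bsub>?Q\<^esub> \<longleftrightarrow> x \<in> W" if x: "x \<in> carrier V" for x
  proof -
    have "\<ominus>\<^bsub>V\<^esub> \<zero>\<^bsub>V\<^esub> = \<zero>\<^bsub>V\<^esub>"
      using M.r_neg[OF M.zero_closed] M.l_zero[OF M.a_inv_closed[OF M.zero_closed]] by simp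
    then have "x \<ominus>\<^bsub>V\<^esub> \<zero>\<^bsub>V\<^esub> = x" using x by (simp only: M.minus_eq M.r_zero)
    then show ?thesis using coset_eq_iff[OF x M.zero_closed] by simp
  qed
  have inj: "inj_on ?p R"
  proof (rule inj_onI, rule ccontr)
    fix r s assume rs: "r \<in> R" "s \<in> R" "?p r = ?p s" "r \<noteq> s"
    \<comment> \<open>If \<open>r\<close> and \<open>s\<close> had the same coset,
      \<open>r - s\<close> would be a combination of \<open>R\<close> inside \<open>W\<close> with
      coefficient 1 at \<open>r\<close>.\<close>
    define c where "c t = (if t = r then \<one>\<^bsub>K\<^esub> else if t = s then \<ominus>\<^bsub>K\<^esub> \<one>\<^bsub>K\<^esub> else \<zero>\<^bsub>K\<^esub>)" for t
    have c: "c \<in> R \<rightarrow> carrier K" by (auto simp: c_def)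
    have V: "r \<in> carrier V" "s \<in> carrier V" using rs R by auto
    have "lincomb c R = lincomb c {r, s}"
      unfolding lincomb_def
      by (rule M.add.finprod_mono_neutral_cong_right)
        (use R rs V in \<open>auto simp: c_def subset_iff\<close>)
    also have "\<dots> = r \<ominus>\<^bsub>V\<^esub> s"
      using rs V by (simp add: lincomb_def c_def M.minus_eq smult_minus_1)
    also have "\<dots> \<in> W" using rs V coset_eq_iff by simp
    finally have "c r = \<zero>\<^bsub>K\<^esub>" using indep c rs by blast
    then show False by (simp add: c_def)
  qed
  have lincomb_im: "Q.lincomb c (?p ` R) = ?p (lincomb (c \<circ> ?p) R)" if "c \<in> ?p ` R \<rightarrow> carrier K" for c
  proof -
    have "Q.lincomb c (?p ` R) = (\<Oplus>\<^bsub>?Q\<^esub>r\<in>R. c (?p r) \<odot>\<^bsub>?Q\<^esub> ?p r)"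
      unfolding Q.lincomb_def
      by (rule Q.add.finprod_reindex) (use inj that R in \<open>auto intro!: Q.smult_closed p.f_im simp: subset_iff Pi_iff\<close>)
    also have "\<dots> = (\<Oplus>\<^bsub>?Q\<^esub>r\<in>R. ?p (c (?p r) \<odot>\<^bsub>V\<^esub> r))"
      by (rule Q.finsum_cong2) (use that R in \<open>auto simp: Pi_iff subset_iff\<close>)
    also have "\<dots> = ?p (lincomb (c \<circ> ?p) R)"
      unfolding lincomb_def
      by (subst p.hom_sum) (use that R in \<open>auto simp: Pi_iff subset_iff\<close>)
    finally show ?thesis .
  qed
  have pR: "?p ` R \<subseteq> carrier ?Q" using R by (auto simp: carrier_quotient)
  have "Q.basis (?p ` R)"
    unfolding Q.basis_def
  proof (intro conjI)
    show "Q.lin_indpt (?p ` R)"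
    proof (rule Q.finite_lin_indpt2)
      fix c assume c: "c \<in> ?p ` R \<rightarrow> carrier K" "Q.lincomb c (?p ` R) = \<zero>\<^bsub>?Q\<^esub>"
      have cp: "c \<circ> ?p \<in> R \<rightarrow> carrier K" using c by auto
      have "lincomb (c \<circ> ?p) R \<in> carrier V" using cp R by (intro lincomb_closed) auto
      moreover have "?p (lincomb (c \<circ> ?p) R) = \<zero>\<^bsub>?Q\<^esub>" using c lincomb_im by simp
      ultimately have "lincomb (c \<circ> ?p) R \<in> W" using zero_iff by blast
      with cp have "(c \<circ> ?p) r = \<zero>\<^bsub>K\<^esub>" if "r \<in> R" for r
        using indep that by blast
      then show "\<forall>v\<in>?p ` R. c v = \<zero>\<^bsub>K\<^esub>" by auto
    qed (use R pR in auto)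
    show "Q.span (?p ` R) = carrier ?Q"
    proof
      show "Q.span (?p ` R) \<subseteq> carrier ?Q"
        using Q.span_is_subset2 pR by blast
      show "carrier ?Q \<subseteq> Q.span (?p ` R)"
      proof
        fix q assume "q \<in> carrier ?Q"
        then obtain v where v: "v \<in> carrier V" "q = ?p v" by (auto simp: carrier_quotient)
        then obtain c where c: "c \<in> R \<rightarrow> carrier K" "v \<ominus>\<^bsub>V\<^esub> lincomb c R \<in> W"
          using spanning by blast
        \<comment> \<open>Coefficients in the quotient are indexed by cosets, so \<open>c\<close> is
          carried over along the inverse of the projection on \<open>R\<close>.\<close>
        define d where "d = c \<circ> the_inv_into R ?p"
        have d: "d (?p r) = c r" if "r \<in> R" for r
          using inj that by (simp add: d_def the_inv_into_f_f)
        have dK: "d \<in> ?p ` R \<rightarrow> carrier K" using c d by auto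
        have "lincomb (d \<circ> ?p) R = lincomb c R"
          unfolding lincomb_def by (rule M.finsum_cong2) (use d c R in \<open>auto simp: Pi_iff subset_iff\<close>)
        then have "Q.lincomb d (?p ` R) = ?p (lincomb c R)"
          using lincomb_im[OF dK] by simp
        also have "\<dots> = q" using c v R coset_eq_iff[of v "lincomb c R"] by simp
        finally show "q \<in> Q.span (?p ` R)"
          using Q.finite_span[of "?p ` R"] R pR dK by auto
      qed
    qed
    show "?p ` R \<subseteq> carrier ?Q" by (fact pR)
  qed
  then have "Q.dim = card (?p ` R)" using R by (intro Q.dim_basis) auto
  then show ?thesis using inj by (simp add: card_image)
qed

end
end

section \<open>Codimension as the size of a set of words\<close>

text \<open>Bridges the locale sums of a module record, in which linear combinations are defined, to
  the type-class sums of polynomials.\<close>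

lemma finsum_free_alg:
  assumes V: "abelian_monoid (free_alg\<lparr>carrier := C\<rparr> :: ('f::field, 'f free_alg) module)"
    and f: "f \<in> A \<rightarrow> C"
  shows "finsum (free_alg\<lparr>carrier := C\<rparr>) f A = sum f A"
proof -
  interpret abelian_monoid "free_alg\<lparr>carrier := C\<rparr> :: ('f, 'f free_alg) module" by (fact V)
  show ?thesis
    using f
  proof (induction A rule: infinite_finite_induct)
    case (insert x A)
    then show ?case by (simp add: Pi_iff finsum_insert) (simp add: free_alg_def)
  next
    case (infinite A)
    then show ?case by (subst finsum_infinite) (simp_all add: free_alg_def)
  next
    case empty
    show ?case by (subst finsum_empty) (simp add: free_alg_def)
  qed
qed

lemma lookup_free_alg_smult [simp]:
  "Poly_Mapping.lookup (c \<odot>\<^bsub>free_alg\<^esub> p) w = c * Poly_Mapping.lookup p w"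
  by (simp add: free_alg_def Poly_Mapping.map.rep_eq when_def)

lemma free_alg_simps [simp]:
  "carrier free_alg = UNIV" "zero free_alg = 0" "add free_alg = (+)"
  by (simp_all add: free_alg_def)

lemma vectorspace_free_alg: "vectorspace class_ring (free_alg :: ('f::field, 'f free_alg) module)"
proof (rule vs_criteria)
  show "field (class_ring :: 'f ring)" by (rule class_field)
  show "\<forall>v\<in>carrier free_alg. \<exists>w\<in>carrier free_alg.
    v \<oplus>\<^bsub>free_alg\<^esub> w = \<zero>\<^bsub>free_alg :: ('f, 'f free_alg) module\<^esub>"
    by (auto intro: exI[of _ "- _"])
qed (auto intro!: poly_mapping_eqI simp: lookup_add algebra_simps)

text \<open>Membership is a condition on the support instead of a span, so closure properties and
  coefficients can be read off from \<open>keys\<close>.\<close>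

definition polys_on :: "indet list set \<Rightarrow> 'f::field free_alg set" where
  "polys_on B = {p. Poly_Mapping.keys p \<subseteq> B}"

lemma submodule_polys_on:
  "submodule class_ring (polys_on B) (free_alg :: ('f::field, 'f free_alg) module)"
proof -
  interpret vectorspace class_ring "free_alg :: ('f, 'f free_alg) module"
    by (rule vectorspace_free_alg)
  show ?thesis
  proof (intro submodule.intro)
    show "module class_ring (free_alg :: ('f, 'f free_alg) module)" by (rule module_axioms)
    show "v \<oplus>\<^bsub>free_alg\<^esub> w \<in> polys_on B" if "v \<in> polys_on B" "w \<in> polys_on B" for v w :: "'f free_alg"
      using that Poly_Mapping.keys_add[of v w] by (auto simp: polys_on_def)
    show "c \<odot>\<^bsub>free_alg\<^esub> v \<in> polys_on B" if "c \<in> carrier class_ring" "v \<in> polys_on B" for c and v :: "'f free_alg"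
      using that by (auto simp: polys_on_def in_keys_iff)
  qed (auto simp: polys_on_def)
qed

lemma vectorspace_polys_on:
  "vectorspace class_ring (free_alg\<lparr>carrier := polys_on B\<rparr> :: ('f::field, 'f free_alg) module)"
proof -
  interpret vectorspace class_ring "free_alg :: ('f, 'f free_alg) module"
    by (rule vectorspace_free_alg)
  show ?thesis
    by (rule subspace_is_vs) (simp add: subspace_def vectorspace_free_alg submodule_polys_on)
qed

lemma single_image_inj: "inj_on (\<lambda>w. Poly_Mapping.single w (1::'f::field)) A"
  by (rule inj_onI) (metis lookup_single_eq lookup_single_not_eq one_neq_zero)

lemma lincomb_singles:
  fixes c :: "'f::field free_alg \<Rightarrow> 'f"
  assumes "R \<subseteq> B" "finite R"
  shows "module.lincomb (free_alg\<lparr>carrier := polys_on B\<rparr>) c ((\<lambda>w. Poly_Mapping.single w 1) ` R)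
    = (\<Sum>w\<in>R. Poly_Mapping.single w (c (Poly_Mapping.single w 1)))"
proof -
  interpret vectorspace class_ring "free_alg\<lparr>carrier := polys_on B\<rparr> :: ('f, 'f free_alg) module"
    by (rule vectorspace_polys_on)
  have s: "c v \<odot>\<^bsub>free_alg\<^esub> Poly_Mapping.single w 1 = Poly_Mapping.single w (c v)" for v w
    by (rule poly_mapping_eqI) (simp add: lookup_single when_def)
  have "lincomb c ((\<lambda>w. Poly_Mapping.single w 1) ` R)
    = (\<Sum>v\<in>(\<lambda>w. Poly_Mapping.single w 1) ` R. c v \<odot>\<^bsub>free_alg\<^esub> v)"
    unfolding lincomb_def
    by (subst finsum_free_alg[OF M.abelian_monoid_axioms])
      (use assms s in \<open>auto simp: polys_on_def split: if_splits\<close>)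
  also have "\<dots> = (\<Sum>w\<in>R. Poly_Mapping.single w (c (Poly_Mapping.single w 1)))"
    by (simp add: sum.reindex[OF single_image_inj] s)
  finally show ?thesis .
qed

lemma multilinear_polys_eq: "(multilinear_polys n :: 'f::field free_alg set) = polys_on (multilinear_words n)"
proof -
  let ?s = "\<lambda>w. Poly_Mapping.single w (1 :: 'f)"
  interpret vectorspace class_ring "free_alg :: ('f, 'f free_alg) module"
    by (rule vectorspace_free_alg)
  \<comment> \<open>The whole algebra is the case \<open>B = UNIV\<close>, which makes
    \<open>lincomb_singles\<close> available in it.\<close>
  have UNIV: "free_alg = (free_alg\<lparr>carrier := polys_on UNIV\<rparr> :: ('f, 'f free_alg) module)"
    by (simp add: polys_on_def free_alg_def)
  have lc: "lincomb c (?s ` A) = (\<Sum>w\<in>A. Poly_Mapping.single w (c (?s w)))" if "finite A" for c A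
    using lincomb_singles[of A UNIV c, folded UNIV] that by simp
  show ?thesis
  proof (intro equalityI subsetI)
    fix p :: "'f free_alg" assume "p \<in> multilinear_polys n"
    then obtain a A where "finite A" "A \<subseteq> ?s ` multilinear_words n" "p = lincomb a A"
      unfolding multilinear_polys_def span_def by blast
    then obtain A' where A': "finite A'" "A' \<subseteq> multilinear_words n" "p = lincomb a (?s ` A')"
      by (metis finite_subset_image)
    then show "p \<in> polys_on (multilinear_words n)"
      unfolding polys_on_def lc[OF A'(1)]
      using Poly_Mapping.keys_sum[of "\<lambda>w. Poly_Mapping.single w (a (?s w))" A'] by (fastforce split: if_splits)
  next
    fix p :: "'f free_alg" assume p: "p \<in> polys_on (multilinear_words n)"
    \<comment> \<open>Coefficients are indexed by vectors; the word of a basis vector is recovered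
      as its only key.\<close>
    define a where "a v = Poly_Mapping.lookup p (the_elem (Poly_Mapping.keys v))" for v :: "'f free_alg"
    have "lincomb a (?s ` Poly_Mapping.keys p) = p"
      unfolding lc[OF finite_keys]
      by (rule poly_mapping_eqI) (auto simp: a_def lookup_sum lookup_single when_def in_keys_iff)
    then show "p \<in> multilinear_polys n"
      using p unfolding multilinear_polys_def span_def polys_on_def
      by (auto intro!: exI[of _ a] exI[of _ "?s ` Poly_Mapping.keys p"])
  qed
qed

section \<open>Identities tested entry by entry\<close>

abbreviation entry :: "(indet \<Rightarrow> 'f::field mat) \<Rightarrow> nat \<Rightarrow> nat \<Rightarrow> indet list \<Rightarrow> 'f" where
  "entry \<phi> i j w \<equiv> eval_word \<phi> w $$ (i, j)"

definition substitutions :: "(indet \<Rightarrow> 'f::field mat) set" where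
  "substitutions = {\<phi>. \<forall>x. \<phi> x \<in> admissible x}"

lemma substitution_carrier: "\<phi> \<in> substitutions \<Longrightarrow> \<phi> x \<in> carrier_mat 3 3"
  by (cases x) (auto simp: substitutions_def component_def UT3_def dest!: spec[of _ x])

lemma eval_word_Nil [simp]: "eval_word \<phi> [] = 1\<^sub>m 3"
  by (simp add: eval_word_def)

lemma eval_word_Cons [simp]: "eval_word \<phi> (x # w) = \<phi> x * eval_word \<phi> w"
  by (simp add: eval_word_def)

lemma eval_word_carrier: "\<phi> \<in> substitutions \<Longrightarrow> eval_word \<phi> w \<in> carrier_mat 3 3"
  by (induction w) (auto intro: mult_carrier_mat substitution_carrier)

lemma eval_poly_carrier_index:
  assumes \<phi>: "\<phi> \<in> substitutions"
  shows "eval_poly \<phi> p \<in> carrier_mat 3 3 \<and> (\<forall>i<3. \<forall>j<3. eval_poly \<phi> p $$ (i, j)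
    = (\<Sum>w\<in>Poly_Mapping.keys p. Poly_Mapping.lookup p w * entry \<phi> i j w))"
proof -
  interpret abelian_group "module_mat TYPE('a) 3 3" by (rule abelian_group_mat)
  have "(\<Oplus>\<^bsub>module_mat TYPE('a) 3 3\<^esub> w \<in> A. Poly_Mapping.lookup p w \<cdot>\<^sub>m eval_word \<phi> w) \<in> carrier_mat 3 3
    \<and> (\<forall>i<3. \<forall>j<3. (\<Oplus>\<^bsub>module_mat TYPE('a) 3 3\<^esub> w \<in> A. Poly_Mapping.lookup p w \<cdot>\<^sub>m eval_word \<phi> w) $$ (i, j)
      = (\<Sum>w\<in>A. Poly_Mapping.lookup p w * entry \<phi> i j w))" if "finite A" for A
    using that
  proof (induction A)
    case (insert w A)
    have "(\<Oplus>\<^bsub>module_mat TYPE('a) 3 3\<^esub> w \<in> insert w A. Poly_Mapping.lookup p w \<cdot>\<^sub>m eval_word \<phi> w)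
      = Poly_Mapping.lookup p w \<cdot>\<^sub>m eval_word \<phi> w
        + (\<Oplus>\<^bsub>module_mat TYPE('a) 3 3\<^esub> w \<in> A. Poly_Mapping.lookup p w \<cdot>\<^sub>m eval_word \<phi> w)"
      using insert eval_word_carrier[OF \<phi>]
      by (subst finsum_insert) (auto simp: module_mat_simps)
    then show ?case
      using insert eval_word_carrier[OF \<phi>, of w] by auto
  qed (auto simp: module_mat_simps)
  then show ?thesis by (simp add: eval_poly_def)
qed

text \<open>The linear extension of \<open>g\<close> to finitely supported combinations, evaluated
  at \<open>p\<close>.\<close>

definition pairing :: "('b \<Rightarrow>\<^sub>0 'f::field) \<Rightarrow> ('b \<Rightarrow> 'f) \<Rightarrow> 'f" where
  "pairing p g = (\<Sum>w\<in>Poly_Mapping.keys p. Poly_Mapping.lookup p w * g w)"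

lemma pairing_eq:
  "finite A \<Longrightarrow> Poly_Mapping.keys p \<subseteq> A \<Longrightarrow> pairing p g = (\<Sum>w\<in>A. Poly_Mapping.lookup p w * g w)"
  unfolding pairing_def by (rule sum.mono_neutral_left) (auto simp: in_keys_iff)

lemma pairing_add: "pairing (p + q) g = pairing p g + pairing q g"
proof -
  let ?A = "Poly_Mapping.keys p \<union> Poly_Mapping.keys q"
  have "pairing (p + q) g = (\<Sum>w\<in>?A. Poly_Mapping.lookup (p + q) w * g w)"
    by (rule pairing_eq) (simp_all add: Poly_Mapping.keys_add)
  also have "\<dots> = (\<Sum>w\<in>?A. Poly_Mapping.lookup p w * g w) + (\<Sum>w\<in>?A. Poly_Mapping.lookup q w * g w)"
    by (simp add: lookup_add algebra_simps sum.distrib)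
  also have "\<dots> = pairing p g + pairing q g"
    by (simp add: pairing_eq[symmetric])
  finally show ?thesis .
qed

lemma pairing_smult: "pairing (c \<odot>\<^bsub>free_alg\<^esub> p) g = c * pairing p g"
proof -
  have "pairing (c \<odot>\<^bsub>free_alg\<^esub> p) g
    = (\<Sum>w\<in>Poly_Mapping.keys p. Poly_Mapping.lookup (c \<odot>\<^bsub>free_alg\<^esub> p) w * g w)"
    by (rule pairing_eq) (auto simp: in_keys_iff)
  then show ?thesis by (simp add: pairing_def sum_distrib_left mult.assoc)
qed

lemma pairing_diff: "pairing (p - q) g = pairing p g - pairing q g"
  using pairing_add[of "p - q" q g] by simp

lemma pairing_sum: "pairing (\<Sum>a\<in>A. p a) g = (\<Sum>a\<in>A. pairing (p a) g)"
  by (induction A rule: infinite_finite_induct) (simp_all add: pairing_add, simp_all add: pairing_def)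

lemma pairing_single: "pairing (Poly_Mapping.single w c) g = c * g w"
  by (simp add: pairing_def)

text \<open>Presents the identities as the common kernel of linear functionals, nine for each
  substitution, so that only scalar functions of words remain to be studied.\<close>

lemma identities_iff:
  "p \<in> identities \<longleftrightarrow> (\<forall>\<phi>\<in>substitutions. \<forall>i<3. \<forall>j<3. pairing p (entry \<phi> i j) = 0)"
proof -
  have "eval_poly \<phi> p = 0\<^sub>m 3 3 \<longleftrightarrow> (\<forall>i<3. \<forall>j<3. pairing p (entry \<phi> i j) = 0)"
    if "\<phi> \<in> substitutions" for \<phi>
    using eval_poly_carrier_index[OF that, of p] unfolding pairing_def
    by (auto simp: mat_eq_iff)
  then show ?thesis by (auto simp: identities_def substitutions_def)
qed

lemma finite_multilinear_words: "finite (multilinear_words n)"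
proof -
  let ?L = "Yp ` {..<n} \<union> Ym ` {..<n} \<union> Zp ` {..<n} \<union> Zm ` {..<n}"
  have "w \<in> {w. set w \<subseteq> ?L \<and> distinct w}" if w: "w \<in> multilinear_words n" for w
  proof -
    have "x \<in> ?L" if "x \<in> set w" for x
    proof -
      have "idx x \<in> {..<n}" using w that by (auto simp: multilinear_words_def)
      then show ?thesis by (cases x) auto
    qed
    moreover have "distinct w" using w by (auto simp: multilinear_words_def distinct_map)
    ultimately show ?thesis by blast
  qed
  moreover have "finite {w. set w \<subseteq> ?L \<and> distinct w}"
    by (rule finite_subset_distinct) auto
  ultimately show ?thesis by (meson finite_subset subsetI)
qed

text \<open>The coefficients are chosen before the substitution and the position: one combination
  must serve for all of them. The argument is a function and not a word, so that sums and
  differences of entries can be treated as well.\<close>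

definition eval_spanned :: "indet list set \<Rightarrow> ((indet \<Rightarrow> 'f::field mat) \<Rightarrow> nat \<Rightarrow> nat \<Rightarrow> 'f) \<Rightarrow> bool" where
  "eval_spanned R v \<longleftrightarrow> (\<exists>c. \<forall>\<phi>\<in>substitutions. \<forall>i<3. \<forall>j<3. v \<phi> i j = (\<Sum>r\<in>R. c r * entry \<phi> i j r))"

definition eval_relation :: "indet list set \<Rightarrow> (indet list \<Rightarrow> 'f::field) \<Rightarrow> bool" where
  "eval_relation R c \<longleftrightarrow> (\<forall>\<phi>\<in>substitutions. \<forall>i<3. \<forall>j<3. (\<Sum>r\<in>R. c r * entry \<phi> i j r) = 0)"

text \<open>By \<open>identities_iff\<close>, spanning and independence modulo the identities are
  statements about the entries of words as functions of the substitution;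
  \<open>dim_quotient\<close> then gives the dimension.\<close>

lemma codimension_eq_card:
  assumes R: "R \<subseteq> multilinear_words n"
    and spanning: "\<And>w. w \<in> multilinear_words n \<Longrightarrow> eval_spanned R (\<lambda>\<phi> i j. entry \<phi> i j w :: 'f)"
    and indep: "\<And>(c :: _ \<Rightarrow> 'f) r. eval_relation R c \<Longrightarrow> r \<in> R \<Longrightarrow> c r = 0"
  shows "codimension TYPE('f::field) n = card R"
proof -
  let ?B = "multilinear_words n" and ?s = "\<lambda>w. Poly_Mapping.single w (1 :: 'f)"
  let ?P = "free_alg\<lparr>carrier := polys_on ?B\<rparr> :: ('f, 'f free_alg) module"
  interpret F: vectorspace class_ring "free_alg :: ('f, 'f free_alg) module"
    by (rule vectorspace_free_alg)
  interpret vectorspace class_ring ?P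
    by (rule vectorspace_polys_on)
  have finR: "finite R" using R finite_multilinear_words finite_subset by blast
  let ?I = "polys_on ?B \<inter> identities :: 'f free_alg set"
  have sub: "submodule class_ring ?I ?P"
  proof (intro submodule.intro)
    show "module class_ring ?P" by (rule module_axioms)
    interpret S: submodule class_ring "polys_on ?B" "free_alg :: ('f, 'f free_alg) module"
      by (rule submodule_polys_on)
    show "v \<oplus>\<^bsub>?P\<^esub> w \<in> ?I" if "v \<in> ?I" "w \<in> ?I" for v w
      using that S.m_closed[of v w] by (auto simp: identities_iff pairing_add)
    show "c \<odot>\<^bsub>?P\<^esub> v \<in> ?I" if "c \<in> carrier class_ring" "v \<in> ?I" for c v
      using that S.smult_closed[of c v] by (auto simp: identities_iff pairing_smult)
  qed (auto simp: polys_on_def identities_iff pairing_def)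
  have lc: "lincomb c (?s ` R) = (\<Sum>w\<in>R. Poly_Mapping.single w (c (?s w)))" for c
    by (rule lincomb_singles[OF R finR])
  have pairing_lc: "pairing (lincomb c (?s ` R)) g = (\<Sum>w\<in>R. c (?s w) * g w)" for c g
    by (simp add: lc pairing_sum pairing_single)
  \<comment> \<open>Subtraction in the restricted record goes through the inverse formed inside it;
    uniqueness of inverses identifies it with the subtraction of the type.\<close>
  have minus: "v \<ominus>\<^bsub>?P\<^esub> w = v - w" if "v \<in> polys_on ?B" "w \<in> polys_on ?B" for v w
  proof -
    have "w \<oplus>\<^bsub>?P\<^esub> (\<ominus>\<^bsub>?P\<^esub> w) = \<zero>\<^bsub>?P\<^esub>" using that by (intro M.r_neg) simp
    then have "\<ominus>\<^bsub>?P\<^esub> w = - w" by (simp add: eq_neg_iff_add_eq_0 add.commute)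
    then show ?thesis by (simp add: M.minus_eq)
  qed
  have sR: "?s ` R \<subseteq> carrier ?P" using R by (auto simp: polys_on_def)
  have "codimension TYPE('f) n = vectorspace.dim class_ring (quotient_module ?P ?I)"
    by (simp add: codimension_def multilinear_polys_eq)
  also have "\<dots> = card (?s ` R)"
  proof (rule dim_quotient[OF sub])
    show "finite (?s ` R)" using finR by simp
    show "?s ` R \<subseteq> carrier ?P" by (fact sR)
    show "c r = \<zero>\<^bsub>class_ring\<^esub>" if "lincomb c (?s ` R) \<in> ?I" "r \<in> ?s ` R" for c r
    proof -
      have "eval_relation R (c \<circ> ?s)"
        using that(1) by (auto simp: eval_relation_def identities_iff pairing_lc)
      then show ?thesis using indep that(2) by fastforce
    qed
  next
    fix v assume "v \<in> carrier ?P"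
    then have v: "v \<in> polys_on ?B" by simp
    have "\<forall>w\<in>?B. \<exists>c. \<forall>\<phi>\<in>substitutions. \<forall>i<3. \<forall>j<3. entry \<phi> i j w = (\<Sum>r\<in>R. c r * entry \<phi> i j r :: 'f)"
      using spanning unfolding eval_spanned_def by (rule ballI)
    from bchoice[OF this] obtain C :: "indet list \<Rightarrow> indet list \<Rightarrow> 'f" where
      C: "\<And>w \<phi> i j. w \<in> ?B \<Longrightarrow> \<phi> \<in> substitutions \<Longrightarrow> i < 3 \<Longrightarrow> j < 3 \<Longrightarrow>
        entry \<phi> i j w = (\<Sum>r\<in>R. C w r * entry \<phi> i j r)"
      by blast
    \<comment> \<open>The expansion \<open>C w\<close> of every word is substituted into
      \<open>v\<close>, and the coefficient of each representative is collected.\<close>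
    define c where "c u = (\<Sum>w\<in>?B. Poly_Mapping.lookup v w * C w (the_elem (Poly_Mapping.keys u)))" for u :: "'f free_alg"
    have c: "c (?s r) = (\<Sum>w\<in>?B. Poly_Mapping.lookup v w * C w r)" for r
      by (simp add: c_def)
    have l: "lincomb c (?s ` R) \<in> polys_on ?B"
      using lincomb_closed[OF sR, of c] by simp
    have "pairing (v - lincomb c (?s ` R)) (entry \<phi> i j) = 0"
      if "\<phi> \<in> substitutions" "i < 3" "j < 3" for \<phi> i j
    proof -
      have "pairing v (entry \<phi> i j) = (\<Sum>w\<in>?B. Poly_Mapping.lookup v w * entry \<phi> i j w)"
        using v by (intro pairing_eq finite_multilinear_words) (simp add: polys_on_def)
      also have "\<dots> = (\<Sum>w\<in>?B. \<Sum>r\<in>R. Poly_Mapping.lookup v w * C w r * entry \<phi> i j r)"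
        using C[OF _ that] by (intro sum.cong) (simp_all add: sum_distrib_left mult.assoc)
      also have "\<dots> = (\<Sum>r\<in>R. c (?s r) * entry \<phi> i j r)"
        by (subst sum.swap) (simp add: c sum_distrib_right)
      finally show ?thesis by (simp add: pairing_diff pairing_lc)
    qed
    moreover have "v - lincomb c (?s ` R) \<in> polys_on ?B"
      using minus[OF v l] M.minus_closed[of v "lincomb c (?s ` R)"] v l by simp
    ultimately have "v \<ominus>\<^bsub>?P\<^esub> lincomb c (?s ` R) \<in> ?I"
      using minus[OF v l] by (simp add: identities_iff)
    then show "\<exists>c\<in>?s ` R \<rightarrow> carrier class_ring. v \<ominus>\<^bsub>?P\<^esub> lincomb c (?s ` R) \<in> ?I"
      by (intro bexI[of _ c]) auto
  qed
  also have "\<dots> = card R" by (rule card_image[OF single_image_inj])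
  finally show ?thesis .
qed

section \<open>Entries of evaluated words\<close>

definition is_z :: "indet \<Rightarrow> bool" where
  "is_z x \<longleftrightarrow> is_Zp x \<or> is_Zm x"

text \<open>The eigenvalue of the involution on the admissible values of the letter.\<close>

definition sgn_of :: "indet \<Rightarrow> 'f::field" where
  "sgn_of x = (if is_Yp x \<or> is_Zp x then 1 else - 1)"

lemma is_z_simps [simp]: "\<not> is_z (Yp i)" "\<not> is_z (Ym i)" "is_z (Zp i)" "is_z (Zm i)"
  by (simp_all add: is_z_def)

lemma sgn_of_simps [simp]:
  "sgn_of (Yp i) = 1" "sgn_of (Ym i) = - 1" "sgn_of (Zp i) = 1" "sgn_of (Zm i) = - 1"
  by (simp_all add: sgn_of_def)

lemma sgn_of_square [simp]: "sgn_of x * sgn_of x = 1" "sgn_of x * (sgn_of x * a) = a"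
  by (simp_all add: sgn_of_def)

lemma all_less_3: "(\<forall>i<3. P i) \<longleftrightarrow> P 0 \<and> P 1 \<and> P (2 :: nat)"
  by (auto simp: numeral_3_eq_3 numeral_2_eq_2 less_Suc_eq)

lemma less_3_cases: "i < 3 \<Longrightarrow> i = 0 \<or> i = 1 \<or> i = (2 :: nat)"
  by auto

text \<open>The reflection exchanges (0,0) with (2,2) and (0,1) with (1,2) and fixes (1,1) and
  (0,2); at a fixed position a skew matrix satisfies a = -a, which forces 0 because 2 is invertible.
  The positions of degree 0 are the diagonal and (0,2), those of degree 1 are (0,1) and
  (1,2).\<close>

lemma substitution_entries:
  fixes \<phi> :: "indet \<Rightarrow> 'f::field_char_0 mat"
  assumes "\<phi> \<in> substitutions"
  shows "\<phi> x $$ (1, 0) = 0" "\<phi> x $$ (2, 0) = 0" "\<phi> x $$ (2, 1) = 0"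
    "\<phi> x $$ (2, 2) = sgn_of x * \<phi> x $$ (0, 0)"
    "\<phi> x $$ (1, 2) = sgn_of x * \<phi> x $$ (0, 1)"
    "is_z x \<Longrightarrow> \<phi> x $$ (0, 0) = 0" "is_z x \<Longrightarrow> \<phi> x $$ (1, 1) = 0" "is_z x \<Longrightarrow> \<phi> x $$ (0, 2) = 0"
    "\<not> is_z x \<Longrightarrow> \<phi> x $$ (0, 1) = 0"
    "is_Ym x \<Longrightarrow> \<phi> x $$ (1, 1) = 0" "is_Ym x \<Longrightarrow> \<phi> x $$ (0, 2) = 0"
proof -
  have adm: "\<phi> x \<in> admissible x" using assms by (simp add: substitutions_def)
  have comp: "\<phi> x \<in> component (if is_z x then 1 else 0)"
    using adm by (cases x) auto
  then have dim: "\<phi> x \<in> carrier_mat 3 3" and low: "upper_triangular (\<phi> x)"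
    by (auto simp: component_def UT3_def)
  have refl: "reflection (\<phi> x) = sgn_of x \<cdot>\<^sub>m \<phi> x"
  proof (cases x)
    case (Yp i) then show ?thesis using adm dim by (auto intro!: eq_matI)
  next
    case (Zp i) then show ?thesis using adm dim by (auto intro!: eq_matI)
  qed (use adm in \<open>auto intro!: eq_matI\<close>)
  have ent: "\<phi> x $$ (2 - j, 2 - i) = sgn_of x * \<phi> x $$ (i, j)" if "i < 3" "j < 3" for i j
    using arg_cong[OF refl, of "\<lambda>A. A $$ (i, j)"] that dim by (simp add: reflection_def)
  have zero: "\<phi> x $$ (i, j) = 0"
    if "i < 3" "j < 3" "grading_tuple ! i - grading_tuple ! j \<noteq> (if is_z x then 1 else 0)" for i j
    using comp that by (auto simp: component_def)
  show "\<phi> x $$ (1, 0) = 0" "\<phi> x $$ (2, 0) = 0" "\<phi> x $$ (2, 1) = 0"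
    using low dim by (auto simp: upper_triangular_def)
  show "\<phi> x $$ (2, 2) = sgn_of x * \<phi> x $$ (0, 0)" using ent[of 0 0] by simp
  show "\<phi> x $$ (1, 2) = sgn_of x * \<phi> x $$ (0, 1)" using ent[of 0 1] by simp
  show "is_z x \<Longrightarrow> \<phi> x $$ (0, 0) = 0" "is_z x \<Longrightarrow> \<phi> x $$ (1, 1) = 0" "is_z x \<Longrightarrow> \<phi> x $$ (0, 2) = 0"
    "\<not> is_z x \<Longrightarrow> \<phi> x $$ (0, 1) = 0"
    using zero[of 0 0] zero[of 1 1] zero[of 0 2] zero[of 0 1] by (simp_all add: grading_tuple_def)
  show "is_Ym x \<Longrightarrow> \<phi> x $$ (1, 1) = 0" "is_Ym x \<Longrightarrow> \<phi> x $$ (0, 2) = 0"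
    using ent[of 1 1] ent[of 0 2] by (auto simp: is_Ym_def)
qed

text \<open>A converse to \<open>substitution_entries\<close>: the free entries can be prescribed
  independently for each letter, and sign and degree fix the rest. All separating substitutions
  below are instances.\<close>

definition generic :: "(indet \<Rightarrow> 'f::field) \<Rightarrow> (indet \<Rightarrow> 'f) \<Rightarrow> (indet \<Rightarrow> 'f) \<Rightarrow> (indet \<Rightarrow> 'f) \<Rightarrow> indet \<Rightarrow> 'f mat" where
  "generic d m c u x = mat 3 3 (\<lambda>(i, j).
     if is_z x then (if i = 0 \<and> j = 1 then u x else if i = 1 \<and> j = 2 then sgn_of x * u x else 0)
     else if i = 0 \<and> j = 0 then d x
     else if i = 2 \<and> j = 2 then sgn_of x * d x
     else if i = 1 \<and> j = 1 \<and> is_Yp x then m x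
     else if i = 0 \<and> j = 2 \<and> is_Yp x then c x
     else 0)"

lemma generic_index [simp]:
  "generic d m c u x $$ (0, 0) = (if is_z x then 0 else d x)"
  "generic d m c u x $$ (Suc 0, Suc 0) = (if is_Yp x then m x else 0)"
  "generic d m c u x $$ (0, 2) = (if is_Yp x then c x else 0)"
  "generic d m c u x $$ (0, Suc 0) = (if is_z x then u x else 0)"
  by (auto simp: generic_def is_z_def is_Yp_def)

lemma generic_substitution: "generic d m c u \<in> substitutions"
proof -
  have comp: "generic d m c u x \<in> component (if is_z x then 1 else 0)" for x
    by (auto simp: component_def UT3_def upper_triangular_def all_less_3 grading_tuple_def generic_def)
  have "reflection (generic d m c u x) = sgn_of x \<cdot>\<^sub>m generic d m c u x" for x
  proof (rule eq_matI)
    fix i j assume "i < dim_row (sgn_of x \<cdot>\<^sub>m generic d m c u x)" "j < dim_col (sgn_of x \<cdot>\<^sub>m generic d m c u x)"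
    then have "i < 3" "j < 3" by (simp_all add: generic_def)
    then show "reflection (generic d m c u x) $$ (i, j) = (sgn_of x \<cdot>\<^sub>m generic d m c u x) $$ (i, j)"
      by (cases x; elim less_3_cases[THEN disjE] disjE) (auto simp: reflection_def generic_def)
  qed (simp_all add: reflection_def generic_def)
  moreover have "- A = - 1 \<cdot>\<^sub>m A" "1 \<cdot>\<^sub>m A = A" for A :: "'a mat"
    by (auto intro!: eq_matI)
  ultimately have "generic d m c u x \<in> admissible x" for x
    using comp[of x] by (cases x) auto
  then show ?thesis by (simp add: substitutions_def)
qed

lemma mult_mat_3_index:
  assumes "A \<in> carrier_mat 3 3" "B \<in> carrier_mat 3 3" "i < 3" "j < 3"
  shows "(A * B) $$ (i, j) = A $$ (i, 0) * B $$ (0, j) + A $$ (i, 1) * B $$ (1, j) + A $$ (i, 2) * (B $$ (2, j) :: 'a::comm_semiring_0)"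
  using assms by (simp add: scalar_prod_def numeral_3_eq_3 numeral_2_eq_2)

lemma eval_word_append:
  assumes "\<phi> \<in> substitutions"
  shows "eval_word \<phi> (p @ q) = eval_word \<phi> p * eval_word \<phi> q"
proof (induction p)
  case Nil
  then show ?case using eval_word_carrier[OF assms, of q] by simp
next
  case (Cons x p)
  then show ?case
    using assoc_mult_mat[OF substitution_carrier[OF assms, of x] eval_word_carrier[OF assms, of p] eval_word_carrier[OF assms, of q]]
    by simp
qed

definition nz :: "indet list \<Rightarrow> nat" where
  "nz w = length (filter is_z w)"

lemma nz_simps [simp]: "nz [] = 0" "nz (x # w) = (if is_z x then Suc (nz w) else nz w)" "nz (p @ q) = nz p + nz q"
  by (simp_all add: nz_def)

lemma nz_eq_0_iff: "nz w = 0 \<longleftrightarrow> (\<forall>x\<in>set w. \<not> is_z x)"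
  by (induction w) auto

lemma nz_SucE:
  assumes "nz w = Suc k"
  obtains p z q where "w = p @ z # q" "nz p = 0" "is_z z" "nz q = k"
  using assms
proof (induction w arbitrary: thesis)
  case (Cons x w)
  show ?case
  proof (cases "is_z x")
    case True
    then show ?thesis using Cons.prems(1)[of "[]" x w] Cons.prems(2) by simp
  next
    case False
    then have "nz w = Suc k" using Cons.prems(2) by simp
    with Cons.IH obtain p z q where "w = p @ z # q" "nz p = 0" "is_z z" "nz q = k" by metis
    then show ?thesis using False Cons.prems(1)[of "x # p" z q] by simp
  qed
qed simp

context
  fixes \<phi> :: "indet \<Rightarrow> 'f::field_char_0 mat"
  assumes \<phi>: "\<phi> \<in> substitutions"
begin

lemma entry_lower: "entry \<phi> 1 0 w = 0" "entry \<phi> 2 0 w = 0" "entry \<phi> 2 1 w = 0"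
proof (induction w)
  case (Cons x w)
  {
    case 1 then show ?case using Cons
      by (simp add: mult_mat_3_index[OF substitution_carrier[OF \<phi>] eval_word_carrier[OF \<phi>]] substitution_entries[OF \<phi>, simplified])
    case 2 then show ?case using Cons
      by (simp add: mult_mat_3_index[OF substitution_carrier[OF \<phi>] eval_word_carrier[OF \<phi>]] substitution_entries[OF \<phi>, simplified])
    case 3 then show ?case using Cons
      by (simp add: mult_mat_3_index[OF substitution_carrier[OF \<phi>] eval_word_carrier[OF \<phi>]] substitution_entries[OF \<phi>, simplified])
  }
qed simp_all

lemma entry_append:
  "entry \<phi> 0 0 (p @ q) = entry \<phi> 0 0 p * entry \<phi> 0 0 q"
  "entry \<phi> 1 1 (p @ q) = entry \<phi> 1 1 p * entry \<phi> 1 1 q"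
  "entry \<phi> 2 2 (p @ q) = entry \<phi> 2 2 p * entry \<phi> 2 2 q"
  "entry \<phi> 0 1 (p @ q) = entry \<phi> 0 0 p * entry \<phi> 0 1 q + entry \<phi> 0 1 p * entry \<phi> 1 1 q"
  "entry \<phi> 1 2 (p @ q) = entry \<phi> 1 1 p * entry \<phi> 1 2 q + entry \<phi> 1 2 p * entry \<phi> 2 2 q"
  "entry \<phi> 0 2 (p @ q) = entry \<phi> 0 0 p * entry \<phi> 0 2 q + entry \<phi> 0 1 p * entry \<phi> 1 2 q
     + entry \<phi> 0 2 p * entry \<phi> 2 2 q"
  using entry_lower[of p] entry_lower[of q]
  by (simp_all add: eval_word_append[OF \<phi>] mult_mat_3_index[OF eval_word_carrier[OF \<phi>] eval_word_carrier[OF \<phi>]])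

lemma entry_single: "i < 3 \<Longrightarrow> j < 3 \<Longrightarrow> entry \<phi> i j [x] = \<phi> x $$ (i, j)"
  using substitution_carrier[OF \<phi>, of x] by simp

lemma entry_Cons:
  "entry \<phi> 0 0 (x # w) = \<phi> x $$ (0, 0) * entry \<phi> 0 0 w"
  "entry \<phi> 1 1 (x # w) = \<phi> x $$ (1, 1) * entry \<phi> 1 1 w"
  "entry \<phi> 2 2 (x # w) = sgn_of x * \<phi> x $$ (0, 0) * entry \<phi> 2 2 w"
  "entry \<phi> 0 1 (x # w) = \<phi> x $$ (0, 0) * entry \<phi> 0 1 w + \<phi> x $$ (0, 1) * entry \<phi> 1 1 w"
  "entry \<phi> 1 2 (x # w) = \<phi> x $$ (1, 1) * entry \<phi> 1 2 w + sgn_of x * \<phi> x $$ (0, 1) * entry \<phi> 2 2 w"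
  "entry \<phi> 0 2 (x # w) = \<phi> x $$ (0, 0) * entry \<phi> 0 2 w + \<phi> x $$ (0, 1) * entry \<phi> 1 2 w
     + \<phi> x $$ (0, 2) * entry \<phi> 2 2 w"
  using entry_append[of "[x]" w] substitution_entries[OF \<phi>, of x]
  by (simp_all only: entry_single append_Cons append_Nil)

lemma entry_Nil:
  "entry \<phi> 0 0 [] = 1" "entry \<phi> 1 1 [] = 1" "entry \<phi> 2 2 [] = 1"
  "entry \<phi> 0 1 [] = 0" "entry \<phi> 1 2 [] = 0" "entry \<phi> 0 2 [] = 0"
  by simp_all

lemma entry_diag:
  "entry \<phi> 0 0 w = (\<Prod>x\<leftarrow>w. \<phi> x $$ (0, 0))"
  "entry \<phi> 1 1 w = (\<Prod>x\<leftarrow>w. \<phi> x $$ (1, 1))"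
  "entry \<phi> 2 2 w = (\<Prod>x\<leftarrow>w. sgn_of x * \<phi> x $$ (0, 0))"
  by (induction w) (simp_all only: entry_Cons entry_Nil list.map prod_list.Nil prod_list.Cons)

lemma entry_diag_eq_0:
  assumes "nz w \<noteq> 0"
  shows "entry \<phi> 0 0 w = 0" "entry \<phi> 1 1 w = 0" "entry \<phi> 2 2 w = 0"
proof -
  obtain x where "x \<in> set w" "is_z x" using assms by (auto simp: nz_eq_0_iff)
  then show "entry \<phi> 0 0 w = 0" "entry \<phi> 1 1 w = 0" "entry \<phi> 2 2 w = 0"
    unfolding entry_diag using substitution_entries[OF \<phi>, of x]
    by (auto simp: prod_list_zero_iff image_iff intro!: bexI[of _ x])
qed

text \<open>A path from 0 to 1 or from 1 to 2 takes exactly one step by an odd letter; all other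
  letters act on the diagonal, where odd letters vanish.\<close>

lemma entry_off_diag_eq_0:
  "nz w \<noteq> 1 \<Longrightarrow> entry \<phi> 0 1 w = 0" "nz w \<noteq> 1 \<Longrightarrow> entry \<phi> 1 2 w = 0"
proof (induction w)
  case (Cons x w)
  {
    case 1 then show ?case using Cons entry_diag_eq_0[of w] substitution_entries[OF \<phi>, of x]
      unfolding entry_Cons by (cases "is_z x"; cases "nz w = 0") simp_all
    case 2 then show ?case using Cons entry_diag_eq_0[of w] substitution_entries[OF \<phi>, of x]
      unfolding entry_Cons by (cases "is_z x"; cases "nz w = 0") simp_all
  }
qed (simp_all only: entry_Nil)

text \<open>A path from 0 to 2 either jumps once by an even letter, with all others on the diagonal,
  or takes two odd steps.\<close>

lemma entry_corner_eq_0: "nz w \<noteq> 0 \<Longrightarrow> nz w \<noteq> 2 \<Longrightarrow> entry \<phi> 0 2 w = 0"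
proof (induction w)
  case (Cons x w)
  then show ?case using entry_diag_eq_0[of w] entry_off_diag_eq_0[of w] substitution_entries[OF \<phi>, of x]
    unfolding entry_Cons by (cases "is_z x"; cases "nz w = 0"; cases "nz w = 1") simp_all
qed simp

text \<open>The only path steps at \<open>z\<close>, so each side of \<open>z\<close> is read at a
  fixed diagonal position. For (0,1) the right side sits at the middle entry, for (1,2) the left
  side; this is why skew letters on both sides annihilate both entries.\<close>

lemma entry_one_z:
  assumes "nz p = 0" "is_z z" "nz q = 0"
  shows "entry \<phi> 0 1 (p @ z # q) = (\<Prod>x\<leftarrow>p. \<phi> x $$ (0, 0)) * \<phi> z $$ (0, 1) * (\<Prod>x\<leftarrow>q. \<phi> x $$ (1, 1))"
    and "entry \<phi> 1 2 (p @ z # q) = (\<Prod>x\<leftarrow>p. \<phi> x $$ (1, 1)) * (sgn_of z * \<phi> z $$ (0, 1)) * (\<Prod>x\<leftarrow>q. sgn_of x * \<phi> x $$ (0, 0))"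
proof -
  have "entry \<phi> 0 1 p = 0" "entry \<phi> 1 2 p = 0" "entry \<phi> 0 1 q = 0" "entry \<phi> 1 2 q = 0"
    using assms entry_off_diag_eq_0 by simp_all
  then show "entry \<phi> 0 1 (p @ z # q) = (\<Prod>x\<leftarrow>p. \<phi> x $$ (0, 0)) * \<phi> z $$ (0, 1) * (\<Prod>x\<leftarrow>q. \<phi> x $$ (1, 1))"
    and "entry \<phi> 1 2 (p @ z # q) = (\<Prod>x\<leftarrow>p. \<phi> x $$ (1, 1)) * (sgn_of z * \<phi> z $$ (0, 1)) * (\<Prod>x\<leftarrow>q. sgn_of x * \<phi> x $$ (0, 0))"
    unfolding entry_append entry_Cons entry_diag by simp_all
qed

text \<open>The letters between the odd ones sit at the middle entry, the outer ones at (0,0) and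
  (2,2), which agree up to sign. A direct jump from 0 to 2 would leave an odd letter on the
  diagonal.\<close>

lemma entry_two_z:
  assumes "nz p = 0" "is_z z" "nz q = 0" "is_z z'" "nz r = 0"
  shows "entry \<phi> 0 2 (p @ z # q @ z' # r) = (\<Prod>x\<leftarrow>p. \<phi> x $$ (0, 0)) * \<phi> z $$ (0, 1)
    * (\<Prod>x\<leftarrow>q. \<phi> x $$ (1, 1)) * (sgn_of z' * \<phi> z' $$ (0, 1)) * (\<Prod>x\<leftarrow>r. sgn_of x * \<phi> x $$ (0, 0))"
proof -
  have "entry \<phi> 0 1 p = 0" using assms entry_off_diag_eq_0 by simp
  moreover have "entry \<phi> 2 2 (z # q @ z' # r) = 0"
    using assms by (intro entry_diag_eq_0) simp
  ultimately have "entry \<phi> 0 2 (p @ z # q @ z' # r) = (\<Prod>x\<leftarrow>p. \<phi> x $$ (0, 0)) * entry \<phi> 0 2 (z # q @ z' # r)"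
    unfolding entry_append entry_diag by simp
  also have "entry \<phi> 0 2 (z # q @ z' # r) = \<phi> z $$ (0, 1) * entry \<phi> 1 2 (q @ z' # r)"
    unfolding entry_Cons using substitution_entries[OF \<phi>, of z] assms by simp
  finally show ?thesis
    using assms by (simp only: entry_one_z mult.assoc)
qed

end

section \<open>Closure properties of the spanned functions\<close>

lemma eval_spanned_cong:
  assumes "\<And>\<phi> i j. \<phi> \<in> substitutions \<Longrightarrow> i < 3 \<Longrightarrow> j < 3 \<Longrightarrow> v \<phi> i j = v' \<phi> i j"
    and "eval_spanned R v'"
  shows "eval_spanned R v"
  using assms unfolding eval_spanned_def by simp

lemma eval_spanned_entry: "finite R \<Longrightarrow> r \<in> R \<Longrightarrow> eval_spanned R (\<lambda>\<phi> i j. entry \<phi> i j r)"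
  unfolding eval_spanned_def by (rule exI[of _ "\<lambda>s. if s = r then 1 else 0"]) (simp add: if_distrib[of "\<lambda>x. x * _"] cong: if_cong)

lemma eval_spanned_0: "eval_spanned R (\<lambda>\<phi> i j. 0)"
  unfolding eval_spanned_def by (rule exI[of _ "\<lambda>s. 0"]) simp

lemma eval_spanned_add:
  assumes "eval_spanned R v" "eval_spanned R v'"
  shows "eval_spanned R (\<lambda>\<phi> i j. v \<phi> i j + v' \<phi> i j)"
proof -
  obtain c c' where
    "\<And>\<phi> i j. \<phi>\<in>substitutions \<Longrightarrow> i<3 \<Longrightarrow> j<3 \<Longrightarrow> v \<phi> i j = (\<Sum>r\<in>R. c r * entry \<phi> i j r)"
    "\<And>\<phi> i j. \<phi>\<in>substitutions \<Longrightarrow> i<3 \<Longrightarrow> j<3 \<Longrightarrow> v' \<phi> i j = (\<Sum>r\<in>R. c' r * entry \<phi> i j r)"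
    using assms unfolding eval_spanned_def by blast
  then show ?thesis
    unfolding eval_spanned_def
    by (intro exI[of _ "\<lambda>r. c r + c' r"]) (simp add: algebra_simps sum.distrib)
qed

lemma eval_spanned_scale:
  assumes "eval_spanned R v"
  shows "eval_spanned R (\<lambda>\<phi> i j. a * v \<phi> i j)"
proof -
  obtain c where
    "\<And>\<phi> i j. \<phi>\<in>substitutions \<Longrightarrow> i<3 \<Longrightarrow> j<3 \<Longrightarrow> v \<phi> i j = (\<Sum>r\<in>R. c r * entry \<phi> i j r)"
    using assms unfolding eval_spanned_def by blast
  then show ?thesis
    unfolding eval_spanned_def
    by (intro exI[of _ "\<lambda>r. a * c r"]) (simp add: sum_distrib_left mult.assoc)
qed

lemma eval_spanned_diff:
  assumes "eval_spanned R v" "eval_spanned R v'"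
  shows "eval_spanned R (\<lambda>\<phi> i j. v \<phi> i j - v' \<phi> i j)"
  using eval_spanned_add[OF assms(1) eval_spanned_scale[OF assms(2), of "- 1"]] by simp

lemma eval_spanned_sum:
  assumes "\<And>k. k \<in> A \<Longrightarrow> eval_spanned R (v k)"
  shows "eval_spanned R (\<lambda>\<phi> i j. \<Sum>k\<in>A. v k \<phi> i j)"
  using assms
  by (induction A rule: infinite_finite_induct) (simp_all add: eval_spanned_0 eval_spanned_add)

section \<open>Labelled blocks of even letters\<close>

definition ylet :: "nat \<Rightarrow> bool \<Rightarrow> indet" where
  "ylet j b = (if b then Yp j else Ym j)"

definition zlet :: "nat \<Rightarrow> bool \<Rightarrow> indet" where
  "zlet j b = (if b then Zp j else Zm j)"

lemma ylet_simps [simp]: "idx (ylet j b) = j" "is_Yp (ylet j b) = b" "is_Ym (ylet j b) = (\<not> b)" "\<not> is_z (ylet j b)"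
  "ylet j b = ylet j' b' \<longleftrightarrow> j = j' \<and> b = b'"
  by (auto simp: ylet_def)

lemma zlet_simps [simp]: "idx (zlet j b) = j" "is_z (zlet j b)" "zlet j b = zlet j' b' \<longleftrightarrow> j = j' \<and> b = b'"
  by (auto simp: zlet_def)

lemma zlet_cases: "is_z x \<Longrightarrow> x = zlet (idx x) (is_Zp x)"
  by (cases x) (simp_all add: zlet_def)

lemma ylet_cases: "\<not> is_z x \<Longrightarrow> x = ylet (idx x) (is_Yp x)"
  by (cases x) (simp_all add: ylet_def)

text \<open>A label \<open>(b, s)\<close> of an index records the block \<open>b\<close> containing its letter and whether the letter is
  symmetric. In \<open>word1\<close> the first component means being left of the odd letter, in \<open>word2\<close> being between
  the odd letters.\<close>

definition block :: "(nat \<Rightarrow> bool \<times> bool) \<Rightarrow> nat set \<Rightarrow> bool \<Rightarrow> indet list" where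
  "block f S b = map (\<lambda>j. ylet j (snd (f j))) (filter (\<lambda>j. fst (f j) = b) (sorted_list_of_set S))"

lemma set_block: "finite S \<Longrightarrow> set (block f S b) = (\<lambda>j. ylet j (snd (f j))) ` {j \<in> S. fst (f j) = b}"
  by (simp add: block_def)

lemma block_idx:
  assumes "finite S"
  shows "distinct (map idx (block f S b))" "set (map idx (block f S b)) = {j \<in> S. fst (f j) = b}"
  using assms by (simp_all add: block_def comp_def)

lemma nz_block [simp]: "nz (block f S b) = 0"
  by (auto simp: nz_eq_0_iff block_def)

lemma prod_list_block:
  assumes "finite S"
  shows "(\<Prod>x\<leftarrow>block f S b. g x) = (\<Prod>j | j \<in> S \<and> fst (f j) = b. g (ylet j (snd (f j))))"
proof -
  have "(\<Prod>x\<leftarrow>block f S b. g x) = (\<Prod>j\<leftarrow>filter (\<lambda>j. fst (f j) = b) (sorted_list_of_set S). g (ylet j (snd (f j))))"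
    by (simp add: block_def comp_def)
  also have "\<dots> = (\<Prod>j\<in>set (filter (\<lambda>j. fst (f j) = b) (sorted_list_of_set S)). g (ylet j (snd (f j))))"
    by (rule prod.distinct_set_conv_list[symmetric]) simp
  finally show ?thesis using assms by simp
qed

text \<open>The labelling of a subword \<open>q\<close> of \<open>w\<close> recovers its letters.\<close>

lemma prod_list_labelled:
  assumes w: "distinct (map idx w)" and p: "set p \<subseteq> set w" "distinct p" "nz p = 0"
    and f: "\<forall>j\<in>S. snd (f j) \<longleftrightarrow> Yp j \<in> set w"
    and S: "{j \<in> S. fst (f j) = b} = idx ` set p"
  shows "(\<Prod>x\<leftarrow>p. g x) = (\<Prod>j | j \<in> S \<and> fst (f j) = b. g (ylet j (snd (f j))))"
proof -
  have inj: "inj_on idx (set w)" using w by (simp add: distinct_map)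
  have "ylet (idx x) (snd (f (idx x))) = x" if x: "x \<in> set p" for x
  proof -
    have "idx x \<in> S" using S x by blast
    moreover have "\<not> is_z x" using p x by (auto simp: nz_eq_0_iff)
    \<comment> \<open>Indices are distinct in \<open>w\<close>, so the letter with this index is
      \<open>x\<close> itself.\<close>
    moreover have "Yp (idx x) \<in> set w \<longleftrightarrow> is_Yp x"
      using inj x p by (cases x) (auto dest: inj_onD[of _ _ "Yp (idx x)" x])
    ultimately show ?thesis using f ylet_cases[of x] by simp
  qed
  then have "(\<Prod>x\<in>set p. g x) = (\<Prod>x\<in>set p. g (ylet (idx x) (snd (f (idx x)))))"
    by simp
  also have "\<dots> = (\<Prod>j\<in>idx ` set p. g (ylet j (snd (f j))))"
    using inj_on_subset[OF inj p(1)] by (simp add: prod.reindex)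
  finally show ?thesis
    using p(2) S by (simp add: prod.distinct_set_conv_list)
qed

lemma Ym_if_Yp_notin: "x \<in> set w \<Longrightarrow> \<not> is_z x \<Longrightarrow> Yp (idx x) \<notin> set w \<Longrightarrow> x = Ym (idx x)"
  by (cases x rule: indet.exhaust) simp_all

lemma prod_list_eq_0_if_Ym:
  assumes "\<phi> \<in> substitutions" "Ym j \<in> set p"
  shows "(\<Prod>x\<leftarrow>p. (\<phi> :: _ \<Rightarrow> 'f::field_char_0 mat) x $$ (1, 1)) = 0"
  using assms substitution_entries(10)[of \<phi> "Ym j"] by (force simp: prod_list_zero_iff)

section \<open>One odd letter\<close>

definition word1 :: "nat \<Rightarrow> nat \<times> bool \<times> (nat \<Rightarrow> bool \<times> bool) \<Rightarrow> indet list" where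
  "word1 n = (\<lambda>(i, s, f). block f ({..<n} - {i}) True @ zlet i s # block f ({..<n} - {i}) False)"

text \<open>One side of the odd letter must be free of skew letters, since otherwise the word is an
  identity; the two families overlap where no skew letter occurs at all. \<open>PiE\<close> fixes
  the labelling outside its domain, so that a word determines its label.\<close>

definition labels1 :: "nat \<Rightarrow> (nat \<times> bool \<times> (nat \<Rightarrow> bool \<times> bool)) set" where
  "labels1 n = (SIGMA i:{..<n}. UNIV \<times> (PiE ({..<n} - {i}) (\<lambda>_. - {(True, False)})
      \<union> PiE ({..<n} - {i}) (\<lambda>_. - {(False, False)})))"

lemma nz_word1 [simp]: "nz (word1 n t) = 1"
  by (simp add: word1_def split: prod.split)

lemma word1_multilinear:
  assumes "t \<in> labels1 n"
  shows "word1 n t \<in> multilinear_words n"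
proof -
  obtain i s f where t: "t = (i, s, f)" "i < n" using assms by (auto simp: labels1_def)
  have "finite ({..<n} - {i})" by simp
  note b = block_idx[OF this, of f]
  have "distinct (map idx (word1 n t))"
    using b(1) b(2)[of True] b(2)[of False] by (auto simp: word1_def t simp del: set_map)
  moreover have "set (map idx (word1 n t)) = {..<n}"
    using t b(2)[of True] b(2)[of False] by (auto simp: word1_def simp del: set_map)
  ultimately show ?thesis by (simp add: multilinear_words_def)
qed

text \<open>Each side enters only through a commutative product of entries, so sorting it by index
  changes nothing. The sorted word is a representative unless skew letters stand on both sides, and
  then the word vanishes under every substitution.\<close>

lemma spanned_one_z:
  assumes w: "w \<in> multilinear_words n" "nz w = 1" and R: "finite R" "word1 n ` labels1 n \<subseteq> R"
  shows "eval_spanned R (\<lambda>\<phi> i j. entry \<phi> i j w :: 'f::field_char_0)"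
proof -
  obtain p z q where wp: "w = p @ z # q" and pzq: "nz p = 0" "is_z z" "nz q = 0"
    using nz_SucE[of w 0] w(2) by auto
  define i where "i = idx z"
  define S where "S = {..<n} - {i}"
  define f where "f = restrict (\<lambda>j. (j \<in> idx ` set p, Yp j \<in> set w)) S"
  have dist: "distinct (map idx w)" and set: "set (map idx w) = {..<n}"
    using w by (auto simp: multilinear_words_def)
  have i: "i < n" using set wp by (auto simp: i_def)
  have p: "set p \<subseteq> set w" "distinct p" and q: "set q \<subseteq> set w" "distinct q"
    using dist wp by (auto simp: distinct_map)
  have "idx ` set p \<inter> idx ` set q = {}" "i \<notin> idx ` set p" "i \<notin> idx ` set q"
    "{..<n} = insert i (idx ` set p \<union> idx ` set q)"
    using dist set
    unfolding i_def wp map_append list.map distinct_append distinct.simps set_append list.set set_map image_Un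
    by blast+
  then have "S = idx ` set p \<union> idx ` set q" "idx ` set p \<inter> idx ` set q = {}"
    unfolding S_def by blast+
  moreover have "fst (f j) \<longleftrightarrow> j \<in> idx ` set p" if "j \<in> S" for j using that by (simp add: f_def)
  ultimately have Sp: "{j \<in> S. fst (f j) = True} = idx ` set p" and Sq: "{j \<in> S. fst (f j) = False} = idx ` set q"
    by blast+
  have "finite S" by (simp add: S_def)
  let ?w = "word1 n (i, is_Zp z, f)"
  have snd: "\<forall>j\<in>S. snd (f j) \<longleftrightarrow> Yp j \<in> set w" by (simp add: f_def)
  note prods = prod_list_labelled[OF dist p pzq(1) snd Sp] prod_list_labelled[OF dist q pzq(3) snd Sq]
    prod_list_block[OF \<open>finite S\<close>]
  have eq: "entry \<phi> k l w = entry \<phi> k l ?w" if \<phi>: "\<phi> \<in> substitutions" and kl: "k < 3" "l < 3"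
    for \<phi> :: "_ \<Rightarrow> 'f mat" and k l
  proof -
    have w': "?w = block f S True @ z # block f S False"
      using zlet_cases[OF pzq(2)] by (simp add: word1_def S_def i_def)
    have "entry \<phi> 0 1 w = entry \<phi> 0 1 ?w" "entry \<phi> 1 2 w = entry \<phi> 1 2 ?w"
      unfolding w' wp entry_one_z[OF \<phi> pzq] entry_one_z[OF \<phi> nz_block pzq(2) nz_block] prods by simp_all
    then show ?thesis
      using less_3_cases[OF kl(1)] less_3_cases[OF kl(2)] entry_lower[OF \<phi>] w(2)
        entry_diag_eq_0[OF \<phi>, of w] entry_diag_eq_0[OF \<phi>, of ?w]
        entry_corner_eq_0[OF \<phi>, of w] entry_corner_eq_0[OF \<phi>, of ?w]
      by (elim disjE) simp_all
  qed
  show ?thesis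
  proof (cases "(i, is_Zp z, f) \<in> labels1 n")
    case True
    show ?thesis
      by (rule eval_spanned_cong[OF eq eval_spanned_entry[OF R(1)]]) (use True R in auto)
  next
    case False
    \<comment> \<open>Failing both families of labellings produces a skew letter on each side, hence
      a zero factor in each of the two entries.\<close>
    then have "\<exists>j\<in>S. f j = (True, False)" "\<exists>j\<in>S. f j = (False, False)"
      using i by (auto simp: labels1_def S_def f_def PiE_def Pi_def extensional_def)
    then obtain j j' where j: "j \<in> S" "f j = (True, False)" and j': "j' \<in> S" "f j' = (False, False)"
      by blast
    obtain x where x: "x \<in> set p" "idx x = j" using Sp j by force
    obtain x' where x': "x' \<in> set q" "idx x' = j'" using Sq j' by force
    have "x = Ym j"
      using x p snd[rule_format, OF j(1)] j(2) pzq(1) Ym_if_Yp_notin[of x w] by (auto simp: nz_eq_0_iff)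
    moreover have "x' = Ym j'"
      using x' q snd[rule_format, OF j'(1)] j'(2) pzq(3) Ym_if_Yp_notin[of x' w] by (auto simp: nz_eq_0_iff)
    ultimately have Ym: "Ym j \<in> set p" "Ym j' \<in> set q" using x x' by auto
    have z: "entry \<phi> k l w = 0" if \<phi>: "\<phi> \<in> substitutions" and kl: "k < 3" "l < 3"
      for \<phi> :: "_ \<Rightarrow> 'f mat" and k l
    proof -
      have "entry \<phi> 0 1 w = 0" "entry \<phi> 1 2 w = 0"
        unfolding wp entry_one_z[OF \<phi> pzq] prod_list_eq_0_if_Ym[OF \<phi> Ym(1)] prod_list_eq_0_if_Ym[OF \<phi> Ym(2)]
        by simp_all
      then show ?thesis
        using less_3_cases[OF kl(1)] less_3_cases[OF kl(2)] entry_lower[OF \<phi>] w(2)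
          entry_diag_eq_0[OF \<phi>, of w] entry_corner_eq_0[OF \<phi>, of w]
        by (elim disjE) simp_all
    qed
    show ?thesis by (rule eval_spanned_cong[OF z eval_spanned_0])
  qed
qed

text \<open>A dual substitution for each representative: the diagonal entries select the letters allowed
  on either side of the odd letter.\<close>

lemma dual_one_z:
  assumes t: "t \<in> labels1 n"
  obtains \<phi> :: "_ \<Rightarrow> 'f::field_char_0 mat" and k l where "\<phi> \<in> substitutions" "k < 3" "l < 3"
    "entry \<phi> k l (word1 n t) \<noteq> 0" "\<And>t'. t' \<in> labels1 n \<Longrightarrow> entry \<phi> k l (word1 n t') \<noteq> 0 \<Longrightarrow> t' = t"
    "\<And>w. nz w \<noteq> 1 \<Longrightarrow> entry \<phi> k l w = 0"
proof -
  obtain i s f where tt: "t = (i, s, f)" and i: "i < n" using t by (auto simp: labels1_def)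
  define S where "S = {..<n} - {i}"
  \<comment> \<open>\<open>b\<close> is a side on which skew letters are allowed
    (\<open>True\<close> for left); the side \<open>\<not> b\<close> is purely symmetric.\<close>
  obtain b where b: "f \<in> PiE S (\<lambda>_. - {(\<not> b, False)})"
  proof -
    have "f \<in> PiE S (\<lambda>_. - {(True, False)}) \<or> f \<in> PiE S (\<lambda>_. - {(False, False)})"
      using t by (simp add: tt labels1_def S_def)
    then show thesis using that[of False] that[of True] by auto
  qed
  \<comment> \<open>Letters on side \<open>b\<close> are read at an end of the diagonal, where
    \<open>d\<close> compares side and symmetry type with the label; those on the other side are
    read at the middle, where \<open>m\<close> does the same for symmetric ones; \<open>u\<close>
    singles out the odd letter.\<close>
  define \<phi> :: "_ \<Rightarrow> 'f mat" where "\<phi> = generic (\<lambda>x. of_bool (f (idx x) = (b, is_Yp x)))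
    (\<lambda>x. of_bool (f (idx x) = (\<not> b, True))) (\<lambda>x. 0) (\<lambda>x. of_bool (x = zlet i s))"
  \<comment> \<open>The left side is read at (0,0) in the entry (0,1), the right side at (2,2) in
    the entry (1,2).\<close>
  define k l where "k = (if b then 0 else 1 :: nat)" and "l = (if b then 1 else 2 :: nat)"
  have \<phi>: "\<phi> \<in> substitutions" unfolding \<phi>_def by (rule generic_substitution)
  have nonzero_iff: "entry \<phi> k l (word1 n (i', s', f')) \<noteq> 0 \<longleftrightarrow> i' = i \<and> s' = s \<and>
    (\<forall>j\<in>{..<n} - {i'}. f j = f' j \<and> (fst (f' j) \<noteq> b \<longrightarrow> snd (f' j)))" for i' s' f'
  proof -
    let ?S = "{..<n} - {i'}"
    have "finite ?S" by simp
    note blk = prod_list_block[OF this, where f = f']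
    have sgn: "sgn_of x \<noteq> (0 :: 'f)" for x by (simp add: sgn_of_def)
    have "entry \<phi> k l (word1 n (i', s', f')) =
      (\<Prod>j | j \<in> ?S \<and> fst (f' j) = b. of_bool (f j = (b, snd (f' j))))
      * of_bool (i' = i \<and> s' = s)
      * (\<Prod>j | j \<in> ?S \<and> fst (f' j) = (\<not> b). if snd (f' j) then of_bool (f j = (\<not> b, True)) else 0)
      * (if b then 1 else sgn_of (zlet i' s') * (\<Prod>j | j \<in> ?S \<and> fst (f' j) = False. sgn_of (ylet j (snd (f' j)))))"
    proof (cases b)
      case True
      then have "k = 0" "l = 1" by (simp_all add: k_def l_def)
      then show ?thesis
        using True unfolding word1_def prod.case blk entry_one_z(1)[OF \<phi> nz_block zlet_simps(2) nz_block]
          \<open>k = 0\<close> \<open>l = 1\<close>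
        by (simp add: \<phi>_def cong: if_cong)
    next
      case False
      then have "k = 1" "l = 2" by (simp_all add: k_def l_def)
      then show ?thesis
        using False unfolding word1_def prod.case blk entry_one_z(2)[OF \<phi> nz_block zlet_simps(2) nz_block]
          \<open>k = 1\<close> \<open>l = 2\<close>
        by (simp add: \<phi>_def prod.distrib mult_ac cong: if_cong)
    qed
    moreover have "(\<Prod>j | j \<in> ?S \<and> fst (f' j) = b. of_bool (f j = (b, snd (f' j)))) \<noteq> (0 :: 'f)
      \<longleftrightarrow> (\<forall>j\<in>?S. fst (f' j) = b \<longrightarrow> f j = f' j)"
      by (auto simp: prod_eq_iff)
    moreover have "(\<Prod>j | j \<in> ?S \<and> fst (f' j) = (\<not> b). if snd (f' j) then of_bool (f j = (\<not> b, True)) else 0) \<noteq> (0 :: 'f)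
      \<longleftrightarrow> (\<forall>j\<in>?S. fst (f' j) \<noteq> b \<longrightarrow> snd (f' j) \<and> f j = f' j)"
      by (auto simp: prod_eq_iff)
    moreover have "(if b then 1 else sgn_of (zlet i' s') * (\<Prod>j | j \<in> ?S \<and> fst (f' j) = False. sgn_of (ylet j (snd (f' j))))) \<noteq> (0 :: 'f)"
      by (simp add: sgn)
    ultimately have "entry \<phi> k l (word1 n (i', s', f')) \<noteq> 0 \<longleftrightarrow> (i' = i \<and> s' = s)
      \<and> (\<forall>j\<in>?S. fst (f' j) = b \<longrightarrow> f j = f' j) \<and> (\<forall>j\<in>?S. fst (f' j) \<noteq> b \<longrightarrow> snd (f' j) \<and> f j = f' j)"
      by (simp only: mult_eq_0_iff of_bool_eq_0_iff de_Morgan_disj) blast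
    then show ?thesis by blast
  qed
  show ?thesis
  proof (rule that[OF \<phi>, of k l])
    show "k < 3" "l < 3" by (simp_all add: k_def l_def)
    show "entry \<phi> k l (word1 n t) \<noteq> 0"
      using b by (auto simp: tt nonzero_iff S_def prod_eq_iff PiE_def Pi_def)
    show "t' = t" if t': "t' \<in> labels1 n" "entry \<phi> k l (word1 n t') \<noteq> 0" for t'
    proof -
      obtain i' s' f' where tt': "t' = (i', s', f')" by (cases t')
      have "f' = f"
        using t' t nonzero_iff[of i' s' f']
        by (intro extensionalityI[of _ S]) (auto simp: tt tt' labels1_def PiE_def S_def)
      then show ?thesis using t' by (simp add: tt tt' nonzero_iff)
    qed
    show "entry \<phi> k l w = 0" if "nz w \<noteq> 1" for w
      using entry_off_diag_eq_0[OF \<phi> that] by (auto simp: k_def l_def)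
  qed
qed

lemma card_Compl_label: "card (- {p :: bool \<times> bool}) = 3"
proof -
  have "card (UNIV :: (bool \<times> bool) set) = 4"
    by (subst UNIV_Times_UNIV[symmetric], subst card_cartesian_product) simp
  then show ?thesis by (simp add: Compl_eq_Diff_UNIV card_Diff_subset)
qed

text \<open>Inclusion-exclusion for each odd letter: either family leaves 3 of the 4 labels per
  index, and both together leave the 2 symmetric ones. The outer factor 2 is the symmetry type of
  the odd letter.\<close>

lemma card_labels1: "card (labels1 n) = n * (2 * (2 * 3 ^ (n - 1) - 2 ^ (n - 1)))"
proof -
  have c: "card (PiE S (\<lambda>_. - {(True, False)}) \<union> PiE S (\<lambda>_. - {(False, False)}) :: (nat \<Rightarrow> bool \<times> bool) set)
    = 2 * 3 ^ card S - 2 ^ card S" if "finite S" for S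
  proof -
    let ?A = "PiE S (\<lambda>_. - {(True, False)}) :: (nat \<Rightarrow> bool \<times> bool) set"
    let ?B = "PiE S (\<lambda>_. - {(False, False)}) :: (nat \<Rightarrow> bool \<times> bool) set"
    have fin: "finite ?A" "finite ?B" using that by (auto intro: finite_PiE)
    have "?A \<inter> ?B = PiE S (\<lambda>_. {(True, True), (False, True)})"
      unfolding PiE_Int by (intro arg_cong[of _ _ "PiE S"] ext) auto
    then have "card (?A \<inter> ?B) = 2 ^ card S" using that by (simp add: card_PiE numeral_2_eq_2)
    moreover have "card ?A = 3 ^ card S" "card ?B = 3 ^ card S" using that by (simp_all add: card_PiE card_Compl_label)
    ultimately show ?thesis using card_Un_Int[OF fin] by simp
  qed
  show ?thesis
    unfolding labels1_def by (subst card_SigmaI) (auto simp: card_cartesian_product c card_UNIV_bool intro!: finite_PiE)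
qed

section \<open>Two odd letters\<close>

text \<open>Up to sign, a letter outside the two odd ones contributes the same on either end, so all
  of them are placed in front; exchanging the odd letters also costs only a sign, so the smaller
  index \<open>i\<close> comes first.\<close>

definition word2 :: "nat \<Rightarrow> (nat \<times> nat) \<times> bool \<times> bool \<times> (nat \<Rightarrow> bool \<times> bool) \<Rightarrow> indet list" where
  "word2 n = (\<lambda>((i', i), s, s', f). block f ({..<n} - {i, i'}) False
     @ zlet i s # block f ({..<n} - {i, i'}) True @ zlet i' s' # [])"

definition labels2 :: "nat \<Rightarrow> ((nat \<times> nat) \<times> bool \<times> bool \<times> (nat \<Rightarrow> bool \<times> bool)) set" where
  "labels2 n = (SIGMA (i', i):(SIGMA i':{..<n}. {..<i'}).
     UNIV \<times> UNIV \<times> PiE ({..<n} - {i, i'}) (\<lambda>_. - {(True, False)}))"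

lemma nz_word2 [simp]: "nz (word2 n t) = 2"
  by (simp add: word2_def split: prod.split)

lemma word2_multilinear:
  assumes "t \<in> labels2 n"
  shows "word2 n t \<in> multilinear_words n"
proof -
  obtain i i' s s' f where t: "t = ((i', i), s, s', f)" "i < i'" "i' < n"
    using assms by (auto simp: labels2_def)
  define S where "S = {..<n} - {i, i'}"
  have w: "word2 n t = block f S False @ zlet i s # block f S True @ zlet i' s' # []"
    by (simp add: word2_def t(1) S_def)
  have S: "finite S" "i \<notin> S" "i' \<notin> S" by (simp_all add: S_def)
  note b = block_idx[OF S(1), of f]
  have "distinct (map idx (word2 n t))"
    using b(1) b(2)[of True] b(2)[of False] t(2) S by (auto simp: w simp del: set_map)
  moreover have "set (map idx (word2 n t)) = {j \<in> S. fst (f j) = False} \<union> {j \<in> S. fst (f j) = True} \<union> {i, i'}"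
    unfolding w map_append set_append list.map list.set b by auto
  then have "set (map idx (word2 n t)) = {..<n}"
    using t(2,3) by (auto simp: S_def)
  ultimately show ?thesis by (simp add: multilinear_words_def)
qed

lemma prod_list_sgn: "(\<Prod>x\<leftarrow>r. sgn_of x * g x) = (\<Prod>x\<leftarrow>r. sgn_of x) * (\<Prod>x\<leftarrow>r. g x :: 'f::field)"
  by (induction r) simp_all

text \<open>Moving the outer letters to the front and ordering the odd ones changes the corner entry
  by a constant sign, and all other entries are 0. If a skew letter stands between the odd ones, the
  word vanishes.\<close>

lemma spanned_two_z:
  assumes w: "w \<in> multilinear_words n" "nz w = 2" and R: "finite R" "word2 n ` labels2 n \<subseteq> R"
  shows "eval_spanned R (\<lambda>\<phi> i j. entry \<phi> i j w :: 'f::field_char_0)"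
proof -
  obtain p z q0 where wp0: "w = p @ z # q0" and pz: "nz p = 0" "is_z z" "nz q0 = 1"
    using nz_SucE[of w 1] w(2) by auto
  obtain q z' r where "q0 = q @ z' # r" and qzr: "nz q = 0" "is_z z'" "nz r = 0"
    using nz_SucE[of q0 0] pz(3) by auto
  with wp0 have wp: "w = p @ z # q @ z' # r" by simp
  have dist: "distinct (map idx w)" and set: "set (map idx w) = {..<n}"
    using w by (auto simp: multilinear_words_def)
  define x x' where "x = (if idx z < idx z' then z else z')" and "x' = (if idx z < idx z' then z' else z)"
  define i i' where "i = idx x" and "i' = idx x'"
  define S where "S = {..<n} - {i, i'}"
  define f where "f = restrict (\<lambda>j. (j \<in> idx ` set q, Yp j \<in> set w)) S"
  have "idx z \<noteq> idx z'" using dist wp by auto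
  then have ii: "i < i'" "i' < n" using set wp by (auto simp: i_def i'_def x_def x'_def)
  have S': "S = {..<n} - {idx z, idx z'}" by (auto simp: S_def i_def i'_def x_def x'_def)
  have pr: "set (p @ r) \<subseteq> set w" "distinct (p @ r)" and q: "set q \<subseteq> set w" "distinct q"
    using dist wp by (auto simp: distinct_map)
  have Sq: "{j \<in> S. fst (f j) = True} = idx ` set q"
    and Spr: "{j \<in> S. fst (f j) = False} = idx ` set (p @ r)"
  proof -
    \<comment> \<open>Opaque names leave a purely set-theoretic problem about disjoint
      unions.\<close>
    define A P R where "A = idx ` set q" and "P = idx ` set p" and "R = idx ` set r"
    define B where "B = P \<union> R"
    have "P \<inter> insert (idx z) (A \<union> insert (idx z') R) = {} \<and> idx z \<notin> A \<union> insert (idx z') R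
        \<and> A \<inter> insert (idx z') R = {} \<and> idx z' \<notin> R"
      using dist unfolding A_def P_def R_def wp
      by (simp only: map_append list.map distinct_append distinct.simps set_append list.set set_map simp_thms)
    moreover have "{..<n} = P \<union> insert (idx z) (A \<union> insert (idx z') R)"
      using set unfolding A_def P_def R_def wp by (simp only: map_append list.map set_append list.set set_map)
    ultimately have "S = A \<union> B" "A \<inter> B = {}" unfolding S' B_def by blast+
    moreover have "fst (f j) \<longleftrightarrow> j \<in> A" if "j \<in> S" for j using that by (simp add: f_def A_def)
    ultimately have "{j \<in> S. fst (f j) = True} = A" "{j \<in> S. fst (f j) = False} = B" by blast+
    then show "{j \<in> S. fst (f j) = True} = idx ` set q" "{j \<in> S. fst (f j) = False} = idx ` set (p @ r)"
      by (simp_all add: A_def B_def P_def R_def image_Un)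
  qed
  have nzpr: "nz (p @ r) = 0" using pz qzr by simp
  have "finite S" by (simp add: S_def)
  have snd: "\<forall>j\<in>S. snd (f j) \<longleftrightarrow> Yp j \<in> set w" by (simp add: f_def)
  let ?t = "((i', i), is_Zp x, is_Zp x', f)"
  let ?w = "word2 n ?t"
  have xz: "is_z x" "is_z x'" using pz qzr by (simp_all add: x_def x'_def)
  have w': "?w = block f S False @ x # block f S True @ x' # []"
    using zlet_cases[OF xz(1)] zlet_cases[OF xz(2)] by (simp add: word2_def S_def i_def i'_def)
  \<comment> \<open>In \<open>w\<close> the letter \<open>z'\<close> and those of \<open>r\<close>
    contribute their signs, in \<open>?w\<close> only \<open>x'\<close> does; as signs are their own
    inverses, the quotient is this product.\<close>
  let ?a = "sgn_of x' * sgn_of z' * (\<Prod>y\<leftarrow>r. sgn_of y) :: 'f"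
  have eq: "entry \<phi> k l w = ?a * entry \<phi> k l ?w" if \<phi>: "\<phi> \<in> substitutions" and kl: "k < 3" "l < 3"
    for \<phi> :: "_ \<Rightarrow> 'f mat" and k l
  proof -
    have "entry \<phi> 0 2 w = sgn_of z' * (\<Prod>y\<leftarrow>r. sgn_of y) * (\<phi> z $$ (0, 1) * \<phi> z' $$ (0, 1))
      * (\<Prod>y\<leftarrow>p @ r. \<phi> y $$ (0, 0)) * (\<Prod>y\<leftarrow>q. \<phi> y $$ (1, 1))"
      unfolding wp entry_two_z[OF \<phi> pz(1,2) qzr] prod_list_sgn by simp
    also have "\<phi> z $$ (0, 1) * \<phi> z' $$ (0, 1) = \<phi> x $$ (0, 1) * \<phi> x' $$ (0, 1)"
      by (simp add: x_def x'_def)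
    also have "(\<Prod>y\<leftarrow>p @ r. \<phi> y $$ (0, 0)) = (\<Prod>y\<leftarrow>block f S False. \<phi> y $$ (0, 0))"
      unfolding prod_list_labelled[OF dist pr nzpr snd Spr] prod_list_block[OF \<open>finite S\<close>] ..
    also have "(\<Prod>y\<leftarrow>q. \<phi> y $$ (1, 1)) = (\<Prod>y\<leftarrow>block f S True. \<phi> y $$ (1, 1))"
      unfolding prod_list_labelled[OF dist q qzr(1) snd Sq] prod_list_block[OF \<open>finite S\<close>] ..
    also have "sgn_of z' * (\<Prod>y\<leftarrow>r. sgn_of y) * (\<phi> x $$ (0, 1) * \<phi> x' $$ (0, 1))
      * (\<Prod>y\<leftarrow>block f S False. \<phi> y $$ (0, 0)) * (\<Prod>y\<leftarrow>block f S True. \<phi> y $$ (1, 1)) = ?a * entry \<phi> 0 2 ?w"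
      unfolding w' entry_two_z[OF \<phi> nz_block xz(1) nz_block xz(2) nz_simps(1)] by simp
    finally have "entry \<phi> 0 2 w = ?a * entry \<phi> 0 2 ?w" .
    then show ?thesis
      using less_3_cases[OF kl(1)] less_3_cases[OF kl(2)] entry_lower[OF \<phi>] w(2)
        entry_diag_eq_0[OF \<phi>, of w] entry_diag_eq_0[OF \<phi>, of ?w]
        entry_off_diag_eq_0[OF \<phi>, of w] entry_off_diag_eq_0[OF \<phi>, of ?w]
      by (elim disjE) simp_all
  qed
  show ?thesis
  proof (cases "?t \<in> labels2 n")
    case True
    show ?thesis
      by (rule eval_spanned_cong[OF eq eval_spanned_scale[OF eval_spanned_entry[OF R(1)]]]) (use True R in auto)
  next
    case False
    then obtain j where j: "j \<in> S" "f j = (True, False)"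
      using ii by (auto simp: labels2_def S_def f_def PiE_def Pi_def extensional_def)
    obtain y where y: "y \<in> set q" "idx y = j" using Sq j by force
    have "y = Ym j"
      using y q snd[rule_format, OF j(1)] j(2) qzr(1) Ym_if_Yp_notin[of y w] by (auto simp: nz_eq_0_iff)
    then have Ym: "Ym j \<in> set q" using y by simp
    have z: "entry \<phi> k l w = 0" if \<phi>: "\<phi> \<in> substitutions" and kl: "k < 3" "l < 3"
      for \<phi> :: "_ \<Rightarrow> 'f mat" and k l
    proof -
      have "entry \<phi> 0 2 w = 0"
        unfolding wp entry_two_z[OF \<phi> pz(1,2) qzr] prod_list_eq_0_if_Ym[OF \<phi> Ym] by simp
      then show ?thesis
        using less_3_cases[OF kl(1)] less_3_cases[OF kl(2)] entry_lower[OF \<phi>] w(2)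
          entry_diag_eq_0[OF \<phi>, of w] entry_off_diag_eq_0[OF \<phi>, of w]
        by (elim disjE) simp_all
    qed
    show ?thesis by (rule eval_spanned_cong[OF z eval_spanned_0])
  qed
qed

lemma spanned_many_z:
  assumes "nz w > 2"
  shows "eval_spanned R (\<lambda>\<phi> i j. entry \<phi> i j w :: 'f::field_char_0)"
proof -
  have "entry \<phi> k l w = 0" if \<phi>: "\<phi> \<in> substitutions" and kl: "k < 3" "l < 3"
      for \<phi> :: "_ \<Rightarrow> 'f mat" and k l
    using less_3_cases[OF kl(1)] less_3_cases[OF kl(2)] entry_lower[OF \<phi>] assms
      entry_diag_eq_0[OF \<phi>, of w] entry_off_diag_eq_0[OF \<phi>, of w] entry_corner_eq_0[OF \<phi>, of w]
    by (elim disjE) simp_all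
  then show ?thesis by (rule eval_spanned_cong[OF _ eval_spanned_0])
qed

text \<open>The parameters \<open>d\<close> and \<open>m\<close> compare the letters outside and
  between the odd ones with the label. The corner parameter is 0, so that words without odd letters
  do not reach the entry (0,2) either.\<close>

lemma dual_two_z:
  assumes t: "t \<in> labels2 n"
  obtains \<phi> :: "_ \<Rightarrow> 'f::field_char_0 mat" and k l where "\<phi> \<in> substitutions" "k < 3" "l < 3"
    "entry \<phi> k l (word2 n t) \<noteq> 0" "\<And>t'. t' \<in> labels2 n \<Longrightarrow> entry \<phi> k l (word2 n t') \<noteq> 0 \<Longrightarrow> t' = t"
    "\<And>w. nz w \<noteq> 2 \<Longrightarrow> entry \<phi> k l w = 0"
proof -
  obtain i i' s s' f where tt: "t = ((i', i), s, s', f)" and i: "i < i'" "i' < n"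
    using t by (auto simp: labels2_def)
  define S where "S = {..<n} - {i, i'}"
  have f: "f \<in> PiE S (\<lambda>_. - {(True, False)})" using t by (simp add: tt labels2_def S_def)
  define \<phi> :: "_ \<Rightarrow> 'f mat" where "\<phi> = generic (\<lambda>x. of_bool (f (idx x) = (False, is_Yp x)))
    (\<lambda>x. of_bool (f (idx x) = (True, True))) (\<lambda>x. 0) (\<lambda>x. of_bool (x = zlet i s \<or> x = zlet i' s'))"
  have \<phi>: "\<phi> \<in> substitutions" unfolding \<phi>_def by (rule generic_substitution)
  have c0: "\<phi> x $$ (0, 2) = 0" for x by (simp add: \<phi>_def)
  have nonzero_iff: "entry \<phi> 0 2 (word2 n ((j', j), r, r', f')) \<noteq> 0 \<longleftrightarrow> j' = i' \<and> j = i \<and> r = s \<and> r' = s' \<and>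
    (\<forall>k\<in>{..<n} - {i, i'}. f k = f' k \<and> (fst (f' k) \<longrightarrow> snd (f' k)))" if "j < j'" for j j' r r' f'
  proof -
    let ?S = "{..<n} - {j, j'}"
    have "finite ?S" by simp
    note blk = prod_list_block[OF this, where f = f']
    have sgn: "sgn_of x \<noteq> (0 :: 'f)" for x by (simp add: sgn_of_def)
    \<comment> \<open>\<open>u\<close> accepts either odd letter of \<open>t\<close> at either
      place; the orderings \<open>i < i'\<close> and \<open>j < j'\<close> exclude the exchanged
      matching and the repetition of one letter.\<close>
    have "(j = i \<and> r = s \<or> j = i' \<and> r = s') \<and> (j' = i \<and> r' = s \<or> j' = i' \<and> r' = s')
      \<longleftrightarrow> j' = i' \<and> j = i \<and> r = s \<and> r' = s'"
      using i that by auto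
    moreover have "entry \<phi> 0 2 (word2 n ((j', j), r, r', f')) =
      (\<Prod>k | k \<in> ?S \<and> fst (f' k) = False. of_bool (f k = (False, snd (f' k))))
      * of_bool (j = i \<and> r = s \<or> j = i' \<and> r = s')
      * (\<Prod>k | k \<in> ?S \<and> fst (f' k) = True. if snd (f' k) then of_bool (f k = (True, True)) else 0)
      * (sgn_of (zlet j' r') * of_bool (j' = i \<and> r' = s \<or> j' = i' \<and> r' = s'))"
      unfolding word2_def prod.case blk
        entry_two_z[OF \<phi> nz_block zlet_simps(2) nz_block zlet_simps(2) nz_simps(1)]
      by (simp add: \<phi>_def cong: if_cong)
    moreover have "(\<Prod>k | k \<in> ?S \<and> fst (f' k) = False. of_bool (f k = (False, snd (f' k)))) \<noteq> (0 :: 'f)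
      \<longleftrightarrow> (\<forall>k\<in>?S. \<not> fst (f' k) \<longrightarrow> f k = f' k)"
      by (auto simp: prod_eq_iff)
    moreover have "(\<Prod>k | k \<in> ?S \<and> fst (f' k) = True. if snd (f' k) then of_bool (f k = (True, True)) else 0) \<noteq> (0 :: 'f)
      \<longleftrightarrow> (\<forall>k\<in>?S. fst (f' k) \<longrightarrow> snd (f' k) \<and> f k = f' k)"
      by (auto simp: prod_eq_iff)
    ultimately have "entry \<phi> 0 2 (word2 n ((j', j), r, r', f')) \<noteq> 0 \<longleftrightarrow> (j' = i' \<and> j = i \<and> r = s \<and> r' = s')
      \<and> (\<forall>k\<in>?S. \<not> fst (f' k) \<longrightarrow> f k = f' k) \<and> (\<forall>k\<in>?S. fst (f' k) \<longrightarrow> snd (f' k) \<and> f k = f' k)"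
      using sgn by (simp only: mult_eq_0_iff of_bool_eq_0_iff de_Morgan_disj) blast
    then show ?thesis by blast
  qed
  show ?thesis
  proof (rule that[OF \<phi>, of 0 2])
    show "entry \<phi> 0 2 (word2 n t) \<noteq> 0"
      using f i by (auto simp: tt nonzero_iff S_def prod_eq_iff PiE_def Pi_def)
    show "t' = t" if t': "t' \<in> labels2 n" "entry \<phi> 0 2 (word2 n t') \<noteq> 0" for t'
    proof -
      obtain j j' r r' f' where tt': "t' = ((j', j), r, r', f')" and j: "j < j'"
        using t'(1) by (auto simp: labels2_def)
      note * = nonzero_iff[OF j, of r r' f', folded tt', THEN iffD1, OF t'(2)]
      have "f' = f"
        using t'(1) t * by (intro extensionalityI[of _ S]) (auto simp: tt tt' labels2_def PiE_def S_def)
      then show ?thesis using * by (simp add: tt tt')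
    qed
    show "entry \<phi> 0 2 w = 0" if "nz w \<noteq> 2" for w
    proof (cases "nz w = 0")
      case True
      then show ?thesis using c0 entry_off_diag_eq_0(2)[OF \<phi>]
      proof (induction w)
        case (Cons x w)
        then show ?case using substitution_entries(9)[OF \<phi>, of x]
          unfolding entry_Cons[OF \<phi>] by (simp split: if_splits)
      qed simp
    next
      case False
      then show ?thesis using entry_corner_eq_0[OF \<phi>] that by blast
    qed
  qed simp_all
qed

text \<open>A pair of indices, two symmetry types, and 3 labels for each remaining index. For
  \<open>n < 2\<close> the first factor is 0, so the truncated exponent is harmless.\<close>

lemma card_labels2: "card (labels2 n) = (n * (n - 1) div 2) * (4 * 3 ^ (n - 2))"
proof -
  let ?D = "SIGMA i':{..<n}. {..<i'}"
  let ?F = "\<lambda>i' i. UNIV \<times> UNIV \<times> PiE ({..<n} - {i, i'}) (\<lambda>_. - {(True, False)})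
    :: (bool \<times> bool \<times> (nat \<Rightarrow> bool \<times> bool)) set"
  have F: "card (?F i' i) = 4 * 3 ^ (n - 2)" if "i' < n" "i < i'" for i i'
  proof -
    have "card ({..<n} - {i, i'}) = n - 2" using that by (simp add: card_Diff_subset)
    then show ?thesis by (simp add: card_cartesian_product card_PiE card_Compl_label card_UNIV_bool)
  qed
  have "card (labels2 n) = (\<Sum>p\<in>?D. card (?F (fst p) (snd p)))"
    unfolding labels2_def case_prod_beta
    by (rule card_SigmaI) (auto intro!: finite_PiE finite_cartesian_product)
  also have "\<dots> = (\<Sum>p\<in>?D. 4 * 3 ^ (n - 2))" by (rule sum.cong) (auto simp: F)
  also have "\<dots> = card ?D * (4 * 3 ^ (n - 2))" by simp
  also have "card ?D = (\<Sum>i'<n. i')" by simp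
  also have "\<dots> = n * (n - 1) div 2" by (cases n) (simp_all add: lessThan_Suc_atMost gauss_sum_nat atMost_atLeast0 mult.commute)
  finally show ?thesis .
qed

section \<open>No odd letter\<close>

text \<open>The sign with which the corner entry of \<open>x\<close> contributes to that of the word: each skew letter
  behind \<open>x\<close> contributes its entry at position \<open>(2, 2)\<close>, the negative of that at \<open>(0, 0)\<close>.\<close>

fun tail_sign :: "indet \<Rightarrow> indet list \<Rightarrow> 'f::field" where
  "tail_sign x [] = 1"
| "tail_sign x (y # w) = (if y = x then \<Prod>z\<leftarrow>w. sgn_of z else tail_sign x w)"

lemma tail_sign_append: "x \<notin> set p \<Longrightarrow> tail_sign x (p @ q) = tail_sign x q"
  by (induction p) auto

lemma prod_list_sgn_eq_1: "\<forall>y\<in>set w. is_Yp y \<Longrightarrow> (\<Prod>z\<leftarrow>w. sgn_of z) = 1"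
  by (induction w) (auto simp: is_Yp_def)

lemma tail_sign_eq_1: "\<forall>y\<in>set w. is_Yp y \<Longrightarrow> tail_sign x w = 1"
  by (induction w) (auto simp: prod_list_sgn_eq_1)

lemma tail_sign_cases: "tail_sign x w = (1 :: 'f::field) \<or> tail_sign x w = (- 1 :: 'f)"
proof -
  have "(\<Prod>z\<leftarrow>w. sgn_of z) = (1 :: 'f) \<or> (\<Prod>z\<leftarrow>w. sgn_of z) = (- 1 :: 'f)" for w
    by (induction w) (auto simp: sgn_of_def)
  then show ?thesis by (induction w) auto
qed

text \<open>A path from 0 to 2 jumps at exactly one letter \<open>x\<close>; letters in front of it
  are read at (0,0), those behind at (2,2), which is (0,0) up to sign. Distinctness turns products
  along the word into products over its set of letters.\<close>

lemma entry_corner_no_z: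
  fixes \<phi> :: "_ \<Rightarrow> 'f::field_char_0 mat"
  assumes \<phi>: "\<phi> \<in> substitutions" and "distinct w" "nz w = 0"
  shows "entry \<phi> 0 2 w = (\<Sum>x\<in>set w. tail_sign x w * (\<phi> x $$ (0, 2) * (\<Prod>y\<in>set w - {x}. \<phi> y $$ (0, 0))))"
  using assms(2,3)
proof (induction w)
  case (Cons x w)
  then have x: "\<not> is_z x" "x \<notin> set w" and w: "distinct w" "nz w = 0" by (auto split: if_splits)
  have "entry \<phi> 2 2 w = (\<Prod>z\<leftarrow>w. sgn_of z) * (\<Prod>y\<in>set w. \<phi> y $$ (0, 0))"
    using w by (simp add: entry_diag[OF \<phi>] prod_list_sgn prod.distinct_set_conv_list)
  then have "entry \<phi> 0 2 (x # w) = \<phi> x $$ (0, 0) * entry \<phi> 0 2 w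
    + \<phi> x $$ (0, 2) * ((\<Prod>z\<leftarrow>w. sgn_of z) * (\<Prod>y\<in>set w. \<phi> y $$ (0, 0)))"
    using substitution_entries(9)[OF \<phi> x(1)] by (simp only: entry_Cons[OF \<phi>]) simp
  also have "\<phi> x $$ (0, 0) * entry \<phi> 0 2 w
    = (\<Sum>y\<in>set w. tail_sign y (x # w) * (\<phi> y $$ (0, 2) * (\<Prod>z\<in>set (x # w) - {y}. \<phi> z $$ (0, 0))))"
    unfolding Cons.IH[OF w] sum_distrib_left
  proof (rule sum.cong[OF refl])
    fix y assume y: "y \<in> set w"
    then have "set (x # w) - {y} = insert x (set w - {y})" using x by auto
    then have "(\<Prod>z\<in>set (x # w) - {y}. \<phi> z $$ (0, 0)) = \<phi> x $$ (0, 0) * (\<Prod>z\<in>set w - {y}. \<phi> z $$ (0, 0))"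
      using x by simp
    then show "\<phi> x $$ (0, 0) * (tail_sign y w * (\<phi> y $$ (0, 2) * (\<Prod>z\<in>set w - {y}. \<phi> z $$ (0, 0))))
      = tail_sign y (x # w) * (\<phi> y $$ (0, 2) * (\<Prod>z\<in>set (x # w) - {y}. \<phi> z $$ (0, 0)))"
      using x y by auto
  qed
  also have "set w = set (x # w) - {x}" using x by auto
  also have "(\<Sum>y\<in>set (x # w) - {x}. tail_sign y (x # w) * (\<phi> y $$ (0, 2) * (\<Prod>z\<in>set (x # w) - {y}. \<phi> z $$ (0, 0))))
      + \<phi> x $$ (0, 2) * ((\<Prod>z\<leftarrow>w. sgn_of z) * (\<Prod>y\<in>set (x # w) - {x}. \<phi> y $$ (0, 0)))
    = (\<Sum>y\<in>set (x # w). tail_sign y (x # w) * (\<phi> y $$ (0, 2) * (\<Prod>z\<in>set (x # w) - {y}. \<phi> z $$ (0, 0))))"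
    by (subst (2) sum.remove[of _ x]) simp_all
  finally show ?case .
qed simp

definition even_letters :: "nat \<Rightarrow> nat set \<Rightarrow> indet set" where
  "even_letters n M = (\<lambda>k. ylet k (k \<notin> M)) ` {..<n}"

text \<open>\<open>M\<close> is the set of indices of the skew letters. In the word \<open>base_word\<close> all skew letters come
  first; in \<open>swap_word\<close> the last of them is moved behind the symmetric letter of index \<open>j\<close>, which flips
  the sign of that letter only.\<close>

definition base_word :: "nat \<Rightarrow> nat set \<Rightarrow> indet list" where
  "base_word n M = block (\<lambda>k. (k \<in> M, k \<notin> M)) {..<n} True @ block (\<lambda>k. (k \<in> M, k \<notin> M)) {..<n} False"

definition swap_word :: "nat \<Rightarrow> nat \<times> nat set \<Rightarrow> indet list" where
  "swap_word n = (\<lambda>(j, M). block (\<lambda>k. (k \<in> M, k \<notin> M)) ({..<n} - {j, Max M}) True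
     @ Yp j # Ym (Max M) # block (\<lambda>k. (k \<in> M, k \<notin> M)) ({..<n} - {j, Max M}) False)"

text \<open>Only symmetric letters have a corner entry, so \<open>j\<close> lies outside
  \<open>M\<close>; and \<open>M\<close> is nonempty because only a skew letter can flip a
  sign.\<close>

definition labels0 :: "nat \<Rightarrow> (nat \<times> nat set) set" where
  "labels0 n = (SIGMA j:{..<n}. Pow ({..<n} - {j}) - {{}})"

text \<open>Each set contains exactly one letter for every index below \<open>n\<close>, so
  inclusion already forces equality.\<close>

lemma even_letters_subset:
  assumes "M \<subseteq> {..<n}" "M' \<subseteq> {..<n}" "even_letters n M' \<subseteq> even_letters n M"
  shows "M' = M"
proof -
  have "k \<notin> M' \<longleftrightarrow> k \<notin> M" if "k < n" for k
  proof -
    have "ylet k (k \<notin> M') \<in> even_letters n M" using assms(3) that by (auto simp: even_letters_def)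
    then show ?thesis by (auto simp: even_letters_def)
  qed
  then show ?thesis using assms(1,2) by blast
qed

lemma labels0D:
  assumes "(j, M) \<in> labels0 n"
  shows "j < n" "j \<notin> M" "M \<subseteq> {..<n}" "finite M" "Max M \<in> M" "Max M < n" "Max M \<noteq> j"
proof -
  show *: "j < n" "j \<notin> M" "M \<subseteq> {..<n}" using assms by (auto simp: labels0_def)
  show "finite M" using *(3) finite_subset by blast
  then show "Max M \<in> M" using assms by (intro Max_in) (auto simp: labels0_def)
  then show "Max M < n" "Max M \<noteq> j" using * by auto
qed

lemma set_even_blocks:
  assumes "finite S"
  shows "set (block (\<lambda>k. (k \<in> M, k \<notin> M)) S True) \<union> set (block (\<lambda>k. (k \<in> M, k \<notin> M)) S False)
    = (\<lambda>k. ylet k (k \<notin> M)) ` S"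
proof -
  have "set (block (\<lambda>k. (k \<in> M, k \<notin> M)) S True) \<union> set (block (\<lambda>k. (k \<in> M, k \<notin> M)) S False)
    = (\<lambda>k. ylet k (k \<notin> M)) ` ({k \<in> S. (k \<in> M) = True} \<union> {k \<in> S. (k \<in> M) = False})"
    by (simp only: set_block[OF assms] image_Un fst_conv snd_conv)
  also have "\<dots> = (\<lambda>k. ylet k (k \<notin> M)) ` S"
    by (intro arg_cong[of _ _ "image _"]) auto
  finally show ?thesis .
qed

lemma even_word_properties:
  assumes "w = base_word n M \<or> (\<exists>j. (j, M) \<in> labels0 n \<and> w = swap_word n (j, M))"
  shows "set w = even_letters n M" "distinct (map idx w)" "nz w = 0" "set (map idx w) = {..<n}"
proof -
  have "set w = even_letters n M \<and> distinct (map idx w)"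
    using assms
  proof (elim disjE exE conjE)
    let ?f = "\<lambda>k. (k \<in> M, k \<notin> M)"
    have fin: "finite {..<n}" by simp
    assume w: "w = base_word n M"
    have "set w = even_letters n M"
      unfolding w base_word_def set_append set_even_blocks[OF fin] even_letters_def ..
    moreover have "distinct (map idx w)"
      unfolding w base_word_def map_append distinct_append using block_idx[OF fin, of ?f] by auto
    ultimately show ?thesis by blast
  next
    let ?f = "\<lambda>k. (k \<in> M, k \<notin> M)"
    fix j assume j: "(j, M) \<in> labels0 n" and w: "w = swap_word n (j, M)"
    define S where "S = {..<n} - {j, Max M}"
    have fin: "finite S" by (simp add: S_def)
    have w': "w = block ?f S True @ Yp j # Ym (Max M) # block ?f S False"
      by (simp add: w swap_word_def S_def)
    note D = labels0D[OF j]
    have "{..<n} = insert j (insert (Max M) S)" using D by (auto simp: S_def)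
    then have "even_letters n M = insert (Yp j) (insert (Ym (Max M)) ((\<lambda>k. ylet k (k \<notin> M)) ` S))"
      using D by (simp add: even_letters_def ylet_def insert_commute)
    also have "\<dots> = set w" by (auto simp: w' set_even_blocks[OF fin, symmetric])
    finally have "set w = even_letters n M" ..
    moreover have "distinct (map idx w)"
      unfolding w' map_append list.map distinct_append distinct.simps list.set block_idx[OF fin]
      using block_idx[OF fin, of ?f] D(7) by (auto simp: S_def simp del: set_map)
    ultimately show ?thesis by blast
  qed
  then show "set w = even_letters n M" "distinct (map idx w)" by auto
  then show "nz w = 0" "set (map idx w) = {..<n}"
    by (auto simp: nz_eq_0_iff even_letters_def image_image)
qed

lemmas base_word_properties = even_word_properties[OF disjI1[OF refl]]

lemma swap_word_properties:
  assumes "(j, M) \<in> labels0 n"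
  shows "set (swap_word n (j, M)) = even_letters n M" "distinct (map idx (swap_word n (j, M)))"
    "nz (swap_word n (j, M)) = 0" "set (map idx (swap_word n (j, M))) = {..<n}"
  by (rule even_word_properties, use assms in blast)+

lemma tail_sign_base_word:
  assumes "k \<notin> M"
  shows "tail_sign (Yp k) (base_word n M) = 1"
proof -
  have "Yp k \<notin> set (block (\<lambda>k. (k \<in> M, k \<notin> M)) {..<n} True)"
    by (auto simp: set_block ylet_def)
  then show ?thesis
    unfolding base_word_def by (subst tail_sign_append) (auto intro!: tail_sign_eq_1 simp: set_block)
qed

lemma tail_sign_swap_word:
  assumes "k \<notin> M"
  shows "tail_sign (Yp k) (swap_word n (j, M)) = (if k = j then - 1 else 1)"
proof -
  have "Yp k \<notin> set (block (\<lambda>k. (k \<in> M, k \<notin> M)) ({..<n} - {j, Max M}) True)"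
    by (auto simp: set_block ylet_def)
  moreover have "\<forall>y\<in>set (block (\<lambda>k. (k \<in> M, k \<notin> M)) ({..<n} - {j, Max M}) False). is_Yp y"
    by (auto simp: set_block)
  ultimately show ?thesis
    unfolding swap_word_def prod.case
    by (subst tail_sign_append) (auto simp: prod_list_sgn_eq_1 tail_sign_eq_1)
qed

text \<open>Words with the same letters agree away from the corner, and there they differ only in
  the signs of the symmetric letters. A swap word differs from the base word in one sign, so
  \<open>w\<close> equals the base word plus one correction, swap word minus base word, for each
  negative sign.\<close>

lemma spanned_no_z:
  assumes w: "w \<in> multilinear_words n" "nz w = 0"
    and R: "finite R" "base_word n ` Pow {..<n} \<subseteq> R" "swap_word n ` labels0 n \<subseteq> R"
  shows "eval_spanned R (\<lambda>\<phi> i j. entry \<phi> i j w :: 'f::field_char_0)"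
proof -
  have dist: "distinct (map idx w)" and set: "set (map idx w) = {..<n}"
    using w by (auto simp: multilinear_words_def)
  have inj: "inj_on idx (set w)" and dw: "distinct w" using dist by (auto simp: distinct_map)
  define M where "M = {k. k < n \<and> Ym k \<in> set w}"
  have M: "M \<subseteq> {..<n}" by (auto simp: M_def)
  have setw: "set w = even_letters n M"
  proof -
    have "x = ylet (idx x) (idx x \<notin> M) \<and> idx x < n" if x: "x \<in> set w" for x
    proof -
      have i: "idx x < n" using set x by auto
      have z: "\<not> is_z x" using w(2) x by (auto simp: nz_eq_0_iff)
      have "is_Yp x \<longleftrightarrow> Ym (idx x) \<notin> set w"
        using x z inj_onD[OF inj, of "Ym (idx x)" x] by (cases x rule: indet.exhaust) auto
      then show ?thesis using ylet_cases[OF z] i by (simp add: M_def)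
    qed
    moreover have "\<exists>x\<in>set w. idx x = k" if "k < n" for k
    proof -
      have "k \<in> idx ` set w" using set that by simp
      then show ?thesis by blast
    qed
    ultimately show ?thesis unfolding even_letters_def by (auto simp: image_iff) metis+
  qed
  define J where "J = {k. k < n \<and> k \<notin> M \<and> tail_sign (Yp k) w \<noteq> (1 :: 'f)}"
  have J: "(k, M) \<in> labels0 n" if "k \<in> J" for k
  proof -
    \<comment> \<open>Without skew letters all signs are 1 and no correction occurs.\<close>
    have "M \<noteq> {}"
    proof
      assume "M = {}"
      then have "\<forall>y\<in>set w. is_Yp y" by (auto simp: setw even_letters_def)
      then show False using that tail_sign_eq_1[of w "Yp k", where ?'a = 'f] by (simp add: J_def)
    qed
    then show ?thesis using that M by (auto simp: labels0_def J_def)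
  qed
  note base = base_word_properties[of n M]
  note swap = swap_word_properties(1-3)[OF J]
  have eq: "entry \<phi> a b w = entry \<phi> a b (base_word n M)
      + (\<Sum>k\<in>J. entry \<phi> a b (swap_word n (k, M)) - entry \<phi> a b (base_word n M))"
    if \<phi>: "\<phi> \<in> substitutions" and ab: "a < 3" "b < 3" for \<phi> :: "_ \<Rightarrow> 'f mat" and a b
  proof -
    have same: "entry \<phi> a b v = entry \<phi> a b w"
      if "set v = even_letters n M" "distinct (map idx v)" "nz v = 0" "\<not> (a = 0 \<and> b = 2)" for v
    proof -
      have dv: "distinct v" using that by (simp add: distinct_map)
      have "entry \<phi> 0 0 v = entry \<phi> 0 0 w" "entry \<phi> 1 1 v = entry \<phi> 1 1 w" "entry \<phi> 2 2 v = entry \<phi> 2 2 w"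
        using that(1) setw unfolding entry_diag[OF \<phi>]
          prod.distinct_set_conv_list[OF dv, symmetric] prod.distinct_set_conv_list[OF dw, symmetric] by simp_all
      then show ?thesis
        using less_3_cases[OF ab(1)] less_3_cases[OF ab(2)] entry_lower[OF \<phi>] that w(2)
          entry_off_diag_eq_0[OF \<phi>, of v] entry_off_diag_eq_0[OF \<phi>, of w]
        by (elim disjE) simp_all
    qed
    show ?thesis
    proof (cases "a = 0 \<and> b = 2")
      case False
      have "entry \<phi> a b (base_word n M) = entry \<phi> a b w" using base False by (intro same)
      moreover have "entry \<phi> a b (swap_word n (k, M)) = entry \<phi> a b w" if "k \<in> J" for k
        using swap[OF that] False by (intro same)
      ultimately show ?thesis by simp
    next
      case True
      let ?L = "even_letters n M"
      define P where "P x = \<phi> x $$ (0, 2) * (\<Prod>y\<in>?L - {x}. \<phi> y $$ (0, 0))" for x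
      have P0: "P (Ym k) = 0" for k
        using substitution_entries(11)[OF \<phi>, of "Ym k"] by (simp add: P_def)
      have corner: "entry \<phi> 0 2 v = (\<Sum>x\<in>?L. tail_sign x v * P x)"
        if "set v = ?L" "distinct (map idx v)" "nz v = 0" for v
        using entry_corner_no_z[OF \<phi>, of v] that by (simp add: P_def distinct_map)
      have L: "(\<exists>k. x = Yp k \<and> k < n \<and> k \<notin> M) \<or> (\<exists>k. x = Ym k)" if "x \<in> ?L" for x
        using that by (auto simp: even_letters_def ylet_def)
      have YpL: "Yp k \<in> ?L" if "k < n" "k \<notin> M" for k
        using that by (auto simp: even_letters_def image_iff ylet_def)
      have finL: "finite ?L" by (simp add: even_letters_def)
      have b: "entry \<phi> 0 2 (base_word n M) = (\<Sum>x\<in>?L. P x)"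
        unfolding corner[OF base(1-3)]
        by (rule sum.cong) (use L in \<open>auto dest!: L simp: P0 tail_sign_base_word\<close>)
      \<comment> \<open>The two words share all letters, and among the symmetric ones only the sign
        of \<open>Yp k\<close> changes, from 1 to -1; just the term of that letter survives.\<close>
      have s: "entry \<phi> 0 2 (swap_word n (k, M)) - entry \<phi> 0 2 (base_word n M) = - (2 * P (Yp k))" if "k \<in> J" for k
      proof -
        have "entry \<phi> 0 2 (swap_word n (k, M)) - entry \<phi> 0 2 (base_word n M)
          = (\<Sum>x\<in>?L. tail_sign x (swap_word n (k, M)) * P x - P x)"
          unfolding corner[OF swap[OF that]] b by (simp add: sum_subtractf)
        also have "\<dots> = (\<Sum>x\<in>?L. if x = Yp k then - (2 * P x) else 0)"
          by (rule sum.cong) (auto dest!: L simp: P0 tail_sign_swap_word)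
        also have "\<dots> = - (2 * P (Yp k))"
          using that YpL[of k] finL by (simp add: J_def)
        finally show ?thesis .
      qed
      have "entry \<phi> 0 2 w - entry \<phi> 0 2 (base_word n M) = (\<Sum>x\<in>?L. tail_sign x w * P x - P x)"
        unfolding corner[OF setw dist w(2)] b by (simp add: sum_subtractf)
      also have "\<dots> = (\<Sum>x\<in>Yp ` J. - (2 * P x))"
      proof (rule sum.mono_neutral_cong_right[OF finL])
        show "Yp ` J \<subseteq> ?L" using YpL by (auto simp: J_def)
        show "\<forall>x\<in>?L - Yp ` J. tail_sign x w * P x - P x = 0"
          by (auto dest!: L simp: P0 J_def)
        show "tail_sign x w * P x - P x = - (2 * P x)" if "x \<in> Yp ` J" for x
          using that tail_sign_cases[of x w, where ?'f = 'f] by (auto simp: J_def)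
      qed
      also have "\<dots> = (\<Sum>k\<in>J. entry \<phi> 0 2 (swap_word n (k, M)) - entry \<phi> 0 2 (base_word n M))"
        by (subst sum.reindex) (auto simp: inj_on_def s intro!: sum.cong)
      finally show ?thesis using True by (simp add: algebra_simps)
    qed
  qed
  have bR: "base_word n M \<in> R" using R(2) M by blast
  have sR: "swap_word n (k, M) \<in> R" if "k \<in> J" for k using R(3) J[OF that] by blast
  show ?thesis
    by (rule eval_spanned_cong, rule eq, assumption+)
      (intro eval_spanned_add eval_spanned_sum eval_spanned_diff eval_spanned_entry R(1) bR sR)
qed

text \<open>The diagonal tests which letters a word has, and the corner parameter marks the letter
  \<open>a\<close>, whose sign then appears in the entry (0,2). Without odd entries, words
  containing odd letters vanish there.\<close>

definition even_dual :: "nat \<Rightarrow> nat set \<Rightarrow> indet \<Rightarrow> indet \<Rightarrow> 'f::field_char_0 mat" where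
  "even_dual n M a = generic (\<lambda>x. of_bool (x \<in> even_letters n M)) (\<lambda>x. 0) (\<lambda>x. of_bool (x = a)) (\<lambda>x. 0)"

lemma even_dual_substitution: "even_dual n M a \<in> substitutions"
  unfolding even_dual_def by (rule generic_substitution)

lemma entry_even_dual_z:
  assumes "nz w \<noteq> 0"
  shows "entry (even_dual n M a) 0 2 w = (0 :: 'f::field_char_0)"
proof -
  note \<phi> = even_dual_substitution[of n M a, where ?'a = 'f]
  have u: "even_dual n M a x $$ (0, 1) = (0 :: 'f)" for x by (simp add: even_dual_def)
  show ?thesis
    using assms
  proof (induction w)
    case (Cons x w)
    then show ?case
      using u substitution_entries[OF \<phi>, of x] entry_diag_eq_0[OF \<phi>, of w]
      unfolding entry_Cons[OF \<phi>] by (cases "is_z x") simp_all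
  qed simp
qed

lemma entry_even_dual:
  assumes M: "M \<subseteq> {..<n}" "M' \<subseteq> {..<n}" and w: "set w = even_letters n M'" "distinct (map idx w)" "nz w = 0"
  shows "entry (even_dual n M a) 0 0 w = (of_bool (M' = M) :: 'f::field_char_0)"
    and "j < n \<Longrightarrow> j \<notin> M \<Longrightarrow> entry (even_dual n M (Yp j)) 0 2 w = (if M' = M then tail_sign (Yp j) w else (0 :: 'f))"
proof -
  let ?L = "even_letters n M" and ?L' = "even_letters n M'"
  have dw: "distinct w" using w by (simp add: distinct_map)
  have d: "even_dual n M a x $$ (0, 0) = (of_bool (x \<in> ?L) :: 'f)" if "x \<in> ?L'" for x a
    using that by (auto simp: even_dual_def even_letters_def)
  have finL: "finite ?L'" by (simp add: even_letters_def)
  have "entry (even_dual n M a) 0 0 w = (\<Prod>x\<in>?L'. of_bool (x \<in> ?L) :: 'f)"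
    unfolding entry_diag[OF even_dual_substitution] prod.distinct_set_conv_list[OF dw, symmetric] w(1)
    by (rule prod.cong) (simp_all add: d)
  also have "\<dots> = of_bool (?L' \<subseteq> ?L)" using finL by (auto intro: prod.neutral simp: subset_iff)
  also have "?L' \<subseteq> ?L \<longleftrightarrow> M' = M" using even_letters_subset[OF M] by auto
  finally show "entry (even_dual n M a) 0 0 w = (of_bool (M' = M) :: 'f)" .
  assume j: "j < n" "j \<notin> M"
  have jL: "Yp j \<in> ?L" using j by (auto simp: even_letters_def image_iff ylet_def)
  have "entry (even_dual n M (Yp j)) 0 2 w
    = (\<Sum>x\<in>?L'. if x = Yp j then tail_sign x w * (\<Prod>y\<in>?L' - {x}. of_bool (y \<in> ?L)) else (0 :: 'f))"
    unfolding entry_corner_no_z[OF even_dual_substitution dw w(3)] w(1)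
  proof (rule sum.cong[OF refl])
    fix x
    have "(\<Prod>y\<in>?L' - {x}. even_dual n M (Yp j) y $$ (0, 0)) = (\<Prod>y\<in>?L' - {x}. of_bool (y \<in> ?L) :: 'f)"
      by (rule prod.cong) (auto simp: d)
    moreover have "even_dual n M (Yp j) x $$ (0, 2) = (of_bool (x = Yp j) :: 'f)"
      by (auto simp: even_dual_def)
    ultimately show "tail_sign x w * (even_dual n M (Yp j) x $$ (0, 2) * (\<Prod>y\<in>?L' - {x}. even_dual n M (Yp j) y $$ (0, 0)))
      = (if x = Yp j then tail_sign x w * (\<Prod>y\<in>?L' - {x}. of_bool (y \<in> ?L)) else (0 :: 'f))"
      by simp
  qed
  also have "\<dots> = (if Yp j \<in> ?L' then tail_sign (Yp j) w * (\<Prod>y\<in>?L' - {Yp j}. of_bool (y \<in> ?L)) else 0)"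
    using finL by simp
  also have "\<dots> = (if M' = M then tail_sign (Yp j) w else 0)"
  proof (cases "M' = M")
    case True
    then show ?thesis using jL by simp
  next
    case False
    \<comment> \<open>The product omits the factor of \<open>Yp j\<close>, but that letter belongs
      to \<open>?L\<close>; a letter outside \<open>?L\<close> is therefore another one, and its
      factor 0 remains.\<close>
    then obtain x where "x \<in> ?L'" "x \<notin> ?L" using even_letters_subset[OF M] by blast
    moreover from this have "x \<noteq> Yp j" using jL by blast
    ultimately have "(\<Prod>y\<in>?L' - {Yp j}. of_bool (y \<in> ?L)) = (0 :: 'f)"
      using finL by (auto intro!: bexI[of _ x])
    then show ?thesis using False by simp
  qed
  finally show "entry (even_dual n M (Yp j)) 0 2 w = (if M' = M then tail_sign (Yp j) w else (0 :: 'f))" .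
qed

lemma card_labels0: "card (labels0 n) = n * (2 ^ (n - 1) - 1)"
  unfolding labels0_def by (subst card_SigmaI) (auto simp: card_Diff_subset card_Pow)

lemma swap_word_inject:
  assumes "(j, M) \<in> labels0 n" "(j', M') \<in> labels0 n" "swap_word n (j, M) = swap_word n (j', M')"
  shows "j = j' \<and> M = M'"
proof -
  have "even_letters n M = even_letters n M'"
    using swap_word_properties(1)[OF assms(1)] swap_word_properties(1)[OF assms(2)] assms(3) by simp
  then have M: "M = M'"
    using even_letters_subset[OF labels0D(3)[OF assms(2)] labels0D(3)[OF assms(1)]] by simp
  \<comment> \<open>The sign recovers \<open>j\<close>. Words do not depend on a field, so one in
    which 1 and -1 differ is chosen.\<close>
  have "tail_sign (Yp j) (swap_word n (j', M')) = (- 1 :: rat)"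
    using tail_sign_swap_word[OF labels0D(2)[OF assms(1)], of n j, where ?'a = rat] assms(3) by simp
  then have "j = j'"
    using tail_sign_swap_word[OF labels0D(2)[OF assms(1)], of n j', where ?'a = rat] M by (simp split: if_splits)
  with M show ?thesis by simp
qed

lemma base_word_inject:
  "M \<subseteq> {..<n} \<Longrightarrow> M' \<subseteq> {..<n} \<Longrightarrow> base_word n M = base_word n M' \<Longrightarrow> M = M'"
  by (metis base_word_properties(1) even_letters_subset subset_refl)

lemma base_word_neq_swap_word:
  assumes "(j, M) \<in> labels0 n" "M' \<subseteq> {..<n}"
  shows "base_word n M' \<noteq> swap_word n (j, M)"
proof
  assume eq: "base_word n M' = swap_word n (j, M)"
  then have "even_letters n M = even_letters n M'"
    using swap_word_properties(1)[OF assms(1)] base_word_properties(1)[of n M'] by simp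
  then have M: "M = M'"
    using even_letters_subset[OF assms(2) labels0D(3)[OF assms(1)]] by simp
  have "tail_sign (Yp j) (base_word n M') = (1 :: rat)" "tail_sign (Yp j) (swap_word n (j, M)) = (- 1 :: rat)"
    using tail_sign_base_word[of j M', where ?'a = rat] tail_sign_swap_word[of j M, where ?'a = rat] labels0D[OF assms(1)] M by simp_all
  then show False using eq by simp
qed

section \<open>Independence, spanning and number of all representatives\<close>

definition representatives :: "nat \<Rightarrow> indet list set" where
  "representatives n = base_word n ` Pow {..<n} \<union> swap_word n ` labels0 n \<union> word1 n ` labels1 n \<union> word2 n ` labels2 n"

lemma representatives_multilinear: "representatives n \<subseteq> multilinear_words n"
proof -
  have "base_word n M \<in> multilinear_words n" for M
    using base_word_properties[of n M] by (simp add: multilinear_words_def)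
  moreover have "swap_word n (j, M) \<in> multilinear_words n" if "(j, M) \<in> labels0 n" for j M
    using swap_word_properties[OF that] by (simp add: multilinear_words_def)
  ultimately show ?thesis
    using word1_multilinear word2_multilinear by (auto simp: representatives_def)
qed

lemma finite_representatives: "finite (representatives n)"
  using representatives_multilinear finite_multilinear_words finite_subset by blast

text \<open>The functional \<open>g\<close> may be nonzero at words whose coefficient is already
  known to be 0, which allows a triangular elimination instead of a full dual basis.\<close>

lemma relation_coeff_eq_0:
  fixes c :: "_ \<Rightarrow> 'f::field"
  assumes "finite R" "r \<in> R" "(\<Sum>s\<in>R. c s * g s) = 0" "g r \<noteq> 0"
    and "\<And>s. s \<in> R \<Longrightarrow> s \<noteq> r \<Longrightarrow> c s = 0 \<or> g s = 0"
  shows "c r = 0"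
proof -
  have "(\<Sum>s\<in>R. c s * g s) = c r * g r + (\<Sum>s\<in>R - {r}. c s * g s)"
    using assms by (simp add: sum.remove)
  also have "(\<Sum>s\<in>R - {r}. c s * g s) = 0" using assms(5) by (intro sum.neutral) auto
  finally show ?thesis using assms by simp
qed

text \<open>Swap words come first: once their coefficients are 0, the entry (0,0) separates the base
  words, which it could not do before because it has the same value at all even words with the same
  letters. Words with odd letters have individual dual substitutions.\<close>

lemma representatives_independent:
  fixes c :: "_ \<Rightarrow> 'f::field_char_0"
  assumes c: "eval_relation (representatives n) c" and r: "r \<in> representatives n"
  shows "c r = 0"
proof -
  let ?R = "representatives n"
  note fin = finite_representatives[of n]
  have rel: "(\<Sum>s\<in>?R. c s * entry \<phi> i j s) = 0" if "\<phi> \<in> substitutions" "i < 3" "j < 3" for \<phi> i j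
    using c that by (simp add: eval_relation_def)
  have R_cases: "(\<exists>M\<subseteq>{..<n}. s = base_word n M) \<or> (\<exists>j M. (j, M) \<in> labels0 n \<and> s = swap_word n (j, M))
      \<or> (\<exists>t\<in>labels1 n. s = word1 n t) \<or> (\<exists>t\<in>labels2 n. s = word2 n t)" if "s \<in> ?R" for s
    using that unfolding representatives_def by auto
  note nz0 = base_word_properties(3) and nz0' = swap_word_properties(3)
  have swap: "c (swap_word n (j, M)) = 0" if jM: "(j, M) \<in> labels0 n" for j M
  proof (rule relation_coeff_eq_0[OF fin])
    let ?\<phi> = "even_dual n M (Yp j) :: _ \<Rightarrow> 'f mat"
    \<comment> \<open>On even words with skew indices \<open>M\<close> the entries (0,2) and (0,0)
      are the sign of \<open>Yp j\<close> and 1; the difference is -2 at the chosen swap word and 0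
      at the base word and the other swap words.\<close>
    let ?g = "\<lambda>s. entry ?\<phi> 0 2 s - entry ?\<phi> 0 0 s"
    note \<phi> = even_dual_substitution[of n M "Yp j", where ?'a = 'f]
    note D = labels0D[OF jM]
    show "swap_word n (j, M) \<in> ?R" using jM by (simp add: representatives_def)
    show "(\<Sum>s\<in>?R. c s * ?g s) = 0"
      using rel[OF \<phi>, of 0 2] rel[OF \<phi>, of 0 0] by (simp add: right_diff_distrib sum_subtractf)
    have even: "?g s = (if M' = M then tail_sign (Yp j) s - 1 else 0)"
      if "M' \<subseteq> {..<n}" "s = base_word n M' \<or> (\<exists>j. (j, M') \<in> labels0 n \<and> s = swap_word n (j, M'))" for s M'
      using entry_even_dual[OF D(3) that(1) even_word_properties(1-3)[OF that(2)], where ?'f = 'f] D(1,2) by simp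
    show "?g (swap_word n (j, M)) \<noteq> 0"
      using jM D(2) by (subst even[OF D(3)]) (auto simp: tail_sign_swap_word)
    show "c s = 0 \<or> ?g s = 0" if s: "s \<in> ?R" "s \<noteq> swap_word n (j, M)" for s
      using R_cases[OF s(1)]
    proof (elim disjE exE bexE conjE)
      fix M' assume "M' \<subseteq> {..<n}" "s = base_word n M'"
      then show ?thesis using even[of M' s] D(2) by (auto simp: tail_sign_base_word)
    next
      fix j' M' assume "(j', M') \<in> labels0 n" "s = swap_word n (j', M')"
      then have "?g s = (if M' = M then tail_sign (Yp j) s - 1 else 0)" "s = swap_word n (j', M')"
        using even[of M' s] labels0D(3) by blast+
      then show ?thesis using s(2) D(2) by (auto simp: tail_sign_swap_word)
    qed (simp_all add: entry_even_dual_z entry_diag_eq_0[OF \<phi>])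
  qed
  show ?thesis
    using R_cases[OF r]
  proof (elim disjE exE bexE conjE)
    fix M assume M: "M \<subseteq> {..<n}" and rM: "r = base_word n M"
    \<comment> \<open>The entry (0,0) does not see the marked letter, so \<open>Yp 0\<close> is a
      placeholder.\<close>
    let ?\<phi> = "even_dual n M (Yp 0) :: _ \<Rightarrow> 'f mat"
    note \<phi> = even_dual_substitution[of n M "Yp 0", where ?'a = 'f]
    have even: "entry ?\<phi> 0 0 s = of_bool (M' = M)" if "M' \<subseteq> {..<n}" "s = base_word n M'" for s M'
      using entry_even_dual(1)[OF M that(1) even_word_properties(1-3)[OF disjI1[OF that(2)]]] .
    show ?thesis
    proof (rule relation_coeff_eq_0[OF fin r rel[OF \<phi>]])
      show "entry ?\<phi> 0 0 r \<noteq> 0" using even[OF M rM] by simp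
      show "c s = 0 \<or> entry ?\<phi> 0 0 s = 0" if s: "s \<in> ?R" "s \<noteq> r" for s
        using R_cases[OF s(1)] s(2) rM even swap
        by (elim disjE exE bexE conjE) (auto simp: entry_diag_eq_0[OF \<phi>])
    qed simp_all
  next
    fix j M assume "(j, M) \<in> labels0 n" "r = swap_word n (j, M)"
    then show ?thesis using swap by simp
  next
    fix t assume t: "t \<in> labels1 n" and rt: "r = word1 n t"
    obtain \<phi> :: "_ \<Rightarrow> 'f mat" and k l where \<phi>: "\<phi> \<in> substitutions" "k < 3" "l < 3" "entry \<phi> k l (word1 n t) \<noteq> 0"
      "\<And>t'. t' \<in> labels1 n \<Longrightarrow> entry \<phi> k l (word1 n t') \<noteq> 0 \<Longrightarrow> t' = t"
      "\<And>w. nz w \<noteq> 1 \<Longrightarrow> entry \<phi> k l w = 0"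
      using dual_one_z[OF t] by metis
    show ?thesis
    proof (rule relation_coeff_eq_0[OF fin r rel[OF \<phi>(1-3)]])
      show "entry \<phi> k l r \<noteq> 0" using \<phi>(4) rt by simp
      show "c s = 0 \<or> entry \<phi> k l s = 0" if s: "s \<in> ?R" "s \<noteq> r" for s
        using R_cases[OF s(1)]
      proof (elim disjE exE bexE conjE)
        fix t' assume "t' \<in> labels1 n" "s = word1 n t'"
        then show ?thesis using \<phi>(5)[of t'] s(2) rt by auto
      qed (use \<phi>(6)[of s] nz0 nz0' in auto)
    qed
  next
    fix t assume t: "t \<in> labels2 n" and rt: "r = word2 n t"
    obtain \<phi> :: "_ \<Rightarrow> 'f mat" and k l where \<phi>: "\<phi> \<in> substitutions" "k < 3" "l < 3" "entry \<phi> k l (word2 n t) \<noteq> 0"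
      "\<And>t'. t' \<in> labels2 n \<Longrightarrow> entry \<phi> k l (word2 n t') \<noteq> 0 \<Longrightarrow> t' = t"
      "\<And>w. nz w \<noteq> 2 \<Longrightarrow> entry \<phi> k l w = 0"
      using dual_two_z[OF t] by metis
    show ?thesis
    proof (rule relation_coeff_eq_0[OF fin r rel[OF \<phi>(1-3)]])
      show "entry \<phi> k l r \<noteq> 0" using \<phi>(4) rt by simp
      show "c s = 0 \<or> entry \<phi> k l s = 0" if s: "s \<in> ?R" "s \<noteq> r" for s
        using R_cases[OF s(1)]
      proof (elim disjE exE bexE conjE)
        fix t' assume "t' \<in> labels2 n" "s = word2 n t'"
        then show ?thesis using \<phi>(5)[of t'] s(2) rt by auto
      qed (use \<phi>(6)[of s] nz0 nz0' in auto)
    qed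
  qed
qed

lemma representatives_spanning:
  assumes w: "w \<in> multilinear_words n"
  shows "eval_spanned (representatives n) (\<lambda>\<phi> i j. entry \<phi> i j w :: 'f::field_char_0)"
proof -
  consider "nz w = 0" | "nz w = 1" | "nz w = 2" | "nz w > 2" by linarith
  then show ?thesis
  proof cases
    case 1
    show ?thesis by (rule spanned_no_z[OF w 1 finite_representatives]) (auto simp: representatives_def)
  next
    case 2
    show ?thesis by (rule spanned_one_z[OF w 2 finite_representatives]) (auto simp: representatives_def)
  next
    case 3
    show ?thesis by (rule spanned_two_z[OF w 3 finite_representatives]) (auto simp: representatives_def)
  qed (rule spanned_many_z)
qed

text \<open>The number of odd letters separates the families, and a sign separates base words from
  swap words. Injectivity of \<open>word1\<close> and \<open>word2\<close> comes from the dual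
  substitutions, which vanish at every other representative of their kind.\<close>

lemma card_representatives:
  "card (representatives n) = 2 ^ n + n * (2 ^ (n - 1) - 1) + n * (2 * (2 * 3 ^ (n - 1) - 2 ^ (n - 1)))
     + (n * (n - 1) div 2) * (4 * 3 ^ (n - 2))"
proof -
  let ?A = "base_word n ` Pow {..<n}" and ?B = "swap_word n ` labels0 n"
  let ?C = "word1 n ` labels1 n" and ?D = "word2 n ` labels2 n"
  have fin: "finite ?A" "finite ?B" "finite ?C" "finite ?D"
    using finite_representatives[of n] by (simp_all add: representatives_def)
  have nzA: "nz s = 0" if "s \<in> ?A" for s
    using that by (auto simp: base_word_properties(3))
  have nzB: "nz s = 0" if "s \<in> ?B" for s
    using that by (auto simp: swap_word_properties(3))
  have nzC: "nz s = 1" if "s \<in> ?C" for s using that by auto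
  have nzD: "nz s = 2" if "s \<in> ?D" for s using that by auto
  have disj1: "?A \<inter> ?B = {}"
  proof -
    have "base_word n M' \<notin> ?B" if "M' \<in> Pow {..<n}" for M'
      using base_word_neq_swap_word[of _ _ n M'] that by auto
    then show ?thesis by blast
  qed
  have disj2: "(?A \<union> ?B) \<inter> ?C = {}"
  proof (rule Int_emptyI)
    fix s assume "s \<in> ?A \<union> ?B" "s \<in> ?C"
    then show False using nzA[of s] nzB[of s] nzC[of s] by (elim UnE) simp_all
  qed
  have disj3: "(?A \<union> ?B \<union> ?C) \<inter> ?D = {}"
  proof (rule Int_emptyI)
    fix s assume "s \<in> ?A \<union> ?B \<union> ?C" "s \<in> ?D"
    then show False using nzA[of s] nzB[of s] nzC[of s] nzD[of s] by (elim UnE) simp_all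
  qed
  have A: "card ?A = 2 ^ n"
    using base_word_inject[of _ n] by (subst card_image) (auto simp: inj_on_def card_Pow)
  have B: "card ?B = n * (2 ^ (n - 1) - 1)"
    using swap_word_inject[of _ _ n] by (subst card_image) (auto simp: inj_on_def card_labels0)
  have "inj_on (word1 n) (labels1 n)"
  proof (rule inj_onI)
    fix t t' assume t: "t \<in> labels1 n" "t' \<in> labels1 n" "word1 n t = word1 n t'"
    show "t = t'"
    proof (rule dual_one_z[OF t(1), where ?'f = rat])
      fix \<phi> :: "indet \<Rightarrow> rat mat" and k l
      assume "entry \<phi> k l (word1 n t) \<noteq> 0"
        and "\<And>t'. t' \<in> labels1 n \<Longrightarrow> entry \<phi> k l (word1 n t') \<noteq> 0 \<Longrightarrow> t' = t"
      then show "t = t'" using t(2,3) by metis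
    qed
  qed
  then have C: "card ?C = n * (2 * (2 * 3 ^ (n - 1) - 2 ^ (n - 1)))"
    by (simp add: card_image card_labels1)
  have "inj_on (word2 n) (labels2 n)"
  proof (rule inj_onI)
    fix t t' assume t: "t \<in> labels2 n" "t' \<in> labels2 n" "word2 n t = word2 n t'"
    show "t = t'"
    proof (rule dual_two_z[OF t(1), where ?'f = rat])
      fix \<phi> :: "indet \<Rightarrow> rat mat" and k l
      assume "entry \<phi> k l (word2 n t) \<noteq> 0"
        and "\<And>t'. t' \<in> labels2 n \<Longrightarrow> entry \<phi> k l (word2 n t') \<noteq> 0 \<Longrightarrow> t' = t"
      then show "t = t'" using t(2,3) by metis
    qed
  qed
  then have D: "card ?D = (n * (n - 1) div 2) * (4 * 3 ^ (n - 2))"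
    by (simp add: card_image card_labels2)
  show ?thesis
    unfolding representatives_def using fin disj1 disj2 disj3 by (simp add: card_Un_disjoint A B C D)
qed

section \<open>The codimension formula\<close>

text \<open>Integer powers over the reals make sense of the negative exponents at
  \<open>n = 0\<close> and \<open>n = 1\<close>, where the formula gives 1 and 4.\<close>

theorem corollary3p4:
  fixes n :: nat
  shows "real (codimension TYPE('f::field_char_0) n)
    = 2 * real n * (real n + 5) * 3 powi (int n - 2) - (real n - 2) * 2 powi (int n - 1) - real n"
proof -
  have codim: "codimension TYPE('f) n = card (representatives n)"
  proof (rule codimension_eq_card)
    show "representatives n \<subseteq> multilinear_words n" by (rule representatives_multilinear)
  qed (fact representatives_spanning, fact representatives_independent)
  \<comment> \<open>For \<open>n < 2\<close> the truncated differences \<open>n - 1\<close> and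
    \<open>n - 2\<close> in the count do not both match the integer exponents, so these values are
    computed separately.\<close>
  consider "n = 0" | "n = 1" | m where "n = Suc (Suc m)" by (metis One_nat_def not0_implies_Suc)
  then show ?thesis
  proof cases
    case 3
    \<comment> \<open>Needed to pass from the subtraction of naturals in the count to that of
      reals.\<close>
    have le: "(2 :: nat) ^ Suc m \<le> 2 * 3 ^ Suc m"
      using power_mono[of "2 :: nat" 3 "Suc m"] by linarith
    have "even (Suc (Suc m) * Suc m)" by simp
    then have half: "real (Suc (Suc m) * Suc m div 2) = (real m + 2) * (real m + 1) / 2"
      by (simp add: real_of_nat_div algebra_simps)
    have pow: "(3 :: real) powi (int n - 2) = 3 ^ m" "(2 :: real) powi (int n - 1) = 2 * 2 ^ m"
      using 3 by (simp_all add: power_int_def nat_add_distrib)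
    have diffs: "real (2 ^ Suc m - 1) = 2 ^ Suc m - 1" "real (2 * 3 ^ Suc m - 2 ^ Suc m) = 2 * 3 ^ Suc m - 2 ^ Suc m"
      using le by (simp_all add: of_nat_diff del: power_Suc)
    have n: "n - 1 = Suc m" "n - 2 = m" "real n = real m + 2" using 3 by simp_all
    have "real (card (representatives n)) = 2 ^ n + real n * real (2 ^ Suc m - 1)
      + real n * (2 * real (2 * 3 ^ Suc m - 2 ^ Suc m)) + real (n * Suc m div 2) * (4 * 3 ^ m)"
      unfolding card_representatives n(1,2) by (simp only: of_nat_add of_nat_mult of_nat_power of_nat_numeral)
    also have "\<dots> = 2 ^ Suc (Suc m) + (real m + 2) * (2 ^ Suc m - 1)
      + (real m + 2) * (2 * (2 * 3 ^ Suc m - 2 ^ Suc m)) + (real m + 2) * (real m + 1) / 2 * (4 * 3 ^ m)"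
      unfolding diffs n(3) using half 3 by (simp only:)
    finally have "real (card (representatives n)) = 2 ^ Suc (Suc m) + (real m + 2) * (2 ^ Suc m - 1)
      + (real m + 2) * (2 * (2 * 3 ^ Suc m - 2 ^ Suc m)) + (real m + 2) * (real m + 1) / 2 * (4 * 3 ^ m)" .
    then show ?thesis
      unfolding codim pow by (simp add: 3 field_simps)
  qed (use codim in \<open>simp_all add: card_representatives power_int_def\<close>)
qed

end
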